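(* For each $n\in\mathbb N$ let $S_n$ be a densely defined closed symmetric operator in a Hilbert space $\mathfrak H_n$ with equal deficiency indices, and let $\Pi_n=\{\mathcal H_n,\Gamma_0^{(n)},\Gamma_1^{(n)}\}$ be a boundary triplet for $S_n^*$. Let $A^*=\bigoplus_{n=1}^\infty S_n^*$. Then the direct sum $\Pi=\bigoplus_{n=1}^\infty\Pi_n$ is an (ordinary) boundary triplet for $A^*$ if and only if $$\max\{C_0,C_1\}<\infty,\qquad C_j:=\sup_{n\in\mathbb N}\|\Gamma_j^{(n)}\|,\quad j=0,1.$$
   Context: Boundary triplet: for a densely defined closed symmetric operator $S$ in a Hilbert space with equal deficiency indices, $\{\mathcal G,\Gamma_0,\Gamma_1\}$ is an (ordinary) boundary triplet for $S^*$ if $\mathcal G$ is a Hilbert space and $\Gamma_0,\Gamma_1:\operatorname{dom}(S^* )\to\mathcal G$ are linear mappings defined on all of $\operatorname{dom}(S^* )$, bounded with respect to the graph norm, such that $(S^*f,g)-(f,S^*g)=(\Gamma_1f,\Gamma_0g)_{\mathcal G}-(\Gamma_0f,\Gamma_1g)_{\mathcal G}$ for all $f,g\in\operatorname{dom}(S^* )$ and $\{\Gamma_0,\Gamma_1\}:\operatorname{dom}(S^* )\to\mathcal G\oplus\mathcal G$ is surjective. Direct sum: $A=\bigoplus_nS_n$ acts in $\mathfrak H=\bigoplus_n\mathfrak H_n$; $\operatorname{dom}(A^* )=\{\bigoplus f_n\in\mathfrak H: f_n\in\operatorname{dom}(S_n^* ),\ \sum\|S_n^*f_n\|^2<\infty\}$.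 $\Pi=\bigoplus_n\Pi_n=\{\mathcal H,\Gamma_0,\Gamma_1\}$ with $\mathcal H=\bigoplus_n\mathcal H_n$, $\Gamma_j=\bigoplus_n\Gamma_j^{(n)}$, $\operatorname{dom}(\Gamma_j)=\{f=\bigoplus f_n\in\operatorname{dom}(A^* ):\sum_n\|\Gamma_j^{(n)}f_n\|^2<\infty\}$. That $\Pi$ is a boundary triplet for $A^*$ includes the requirement $\operatorname{dom}(\Gamma_0)=\operatorname{dom}(\Gamma_1)=\operatorname{dom}(A^* )$. $\|\Gamma_j^{(n)}\|$ is the norm of $\Gamma_j^{(n)}$ as an operator from $\operatorname{dom}(S_n^* )$ with the graph norm $(\|f\|^2+\|S_n^*f\|^2)^{1/2}$ to $\mathcal H_n$. *)

theory Defs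
  imports
    Complex_Main
    "HOL-Library.Function_Algebras"
    "HOL-Library.Equipollence"
    "HOL-Library.Extended_Nonnegative_Real"
begin

section \<open>Complex Hilbert spaces with an explicit carrier\<close>

text \<open>
  The members of a sequence of Hilbert spaces are different spaces, so a Hilbert space cannot be
  a type here. It is a linear subspace of an ambient complex vector space, with an
  inner product of its own that is constrained on that subspace only; the ambient space carries no
  norm or topology. Any sequence of Hilbert spaces can be put into this form by taking
  their algebraic direct sum as the ambient space. Inner products are linear in the first argument.
\<close>

record 'a hspace =
  hcarrier :: "'a set"
  hscale :: "complex \<Rightarrow> 'a \<Rightarrow> 'a"
  hinner :: "'a \<Rightarrow> 'a \<Rightarrow> complex"

definition hnorm :: "'a hspace \<Rightarrow> 'a \<Rightarrow> real" where
  "hnorm H x = sqrt (Re (hinner H x x))"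

locale hilbert_space = vector_space "hscale H" for H :: "'a::ab_group_add hspace" +
  assumes subspace_carrier: "subspace (hcarrier H)"
    and inner_add_left:
      "\<lbrakk>x \<in> hcarrier H; y \<in> hcarrier H; z \<in> hcarrier H\<rbrakk>
        \<Longrightarrow> hinner H (x + y) z = hinner H x z + hinner H y z"
    and inner_scale_left:
      "\<lbrakk>x \<in> hcarrier H; y \<in> hcarrier H\<rbrakk> \<Longrightarrow> hinner H (hscale H c x) y = c * hinner H x y"
    and inner_commute:
      "\<lbrakk>x \<in> hcarrier H; y \<in> hcarrier H\<rbrakk> \<Longrightarrow> hinner H y x = cnj (hinner H x y)"
    and inner_nonneg: "x \<in> hcarrier H \<Longrightarrow> 0 \<le> Re (hinner H x x)"
    and inner_eq_zeroD: "\<lbrakk>x \<in> hcarrier H; hinner H x x = 0\<rbrakk> \<Longrightarrow> x = 0"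
    and complete:
      "\<lbrakk>\<And>n. X n \<in> hcarrier H;
        \<forall>e>0. \<exists>N. \<forall>m\<ge>N. \<forall>n\<ge>N. hnorm H (X m - X n) < e\<rbrakk>
        \<Longrightarrow> \<exists>x\<in>hcarrier H. (\<lambda>n. hnorm H (X n - x)) \<longlonglongrightarrow> 0"

definition hdsum :: "(nat \<Rightarrow> 'a hspace) \<Rightarrow> (nat \<Rightarrow> 'a) hspace" where
  "hdsum H =
    \<lparr>hcarrier = {f. (\<forall>n. f n \<in> hcarrier (H n)) \<and> summable (\<lambda>n. (hnorm (H n) (f n))\<^sup>2)},
     hscale = (\<lambda>c f n. hscale (H n) c (f n)),
     hinner = (\<lambda>f g. \<Sum>n. hinner (H n) (f n) (g n))\<rparr>"


section \<open>Unbounded operators\<close>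

text \<open>
  An operator is identified with its graph: \<open>(f, g) \<in> T\<close> means that \<open>f\<close> lies in the domain of
  \<open>T\<close> and \<open>T f = g\<close>; the domain of \<open>T\<close> is \<open>Domain T\<close>.
\<close>

type_synonym ('a, 'b) operator = "('a \<times> 'b) set"

definition linear_operator ::
    "'a::ab_group_add hspace \<Rightarrow> 'b::ab_group_add hspace \<Rightarrow> ('a, 'b) operator \<Rightarrow> bool" where
  "linear_operator H K T \<longleftrightarrow>
     T \<subseteq> hcarrier H \<times> hcarrier K \<and> single_valued T \<and> (0, 0) \<in> T \<and>
     (\<forall>f g f' g'. (f, g) \<in> T \<longrightarrow> (f', g') \<in> T \<longrightarrow> (f + f', g + g') \<in> T) \<and>
     (\<forall>c f g. (f, g) \<in> T \<longrightarrow> (hscale H c f, hscale K c g) \<in> T)"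

definition densely_defined :: "'a::ab_group_add hspace \<Rightarrow> ('a, 'b) operator \<Rightarrow> bool" where
  "densely_defined H T \<longleftrightarrow>
     (\<forall>x\<in>hcarrier H. \<forall>e>0. \<exists>f\<in>Domain T. hnorm H (x - f) < e)"

definition closed_operator ::
    "'a::ab_group_add hspace \<Rightarrow> 'b::ab_group_add hspace \<Rightarrow> ('a, 'b) operator \<Rightarrow> bool" where
  "closed_operator H K T \<longleftrightarrow>
     (\<forall>F G f g. (\<forall>n::nat. (F n, G n) \<in> T) \<longrightarrow> f \<in> hcarrier H \<longrightarrow> g \<in> hcarrier K \<longrightarrow>
        (\<lambda>n. hnorm H (F n - f)) \<longlonglongrightarrow> 0 \<longrightarrow> (\<lambda>n. hnorm K (G n - g)) \<longlonglongrightarrow> 0 \<longrightarrow>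
        (f, g) \<in> T)"

definition symmetric_operator :: "'a hspace \<Rightarrow> ('a, 'a) operator \<Rightarrow> bool" where
  "symmetric_operator H S \<longleftrightarrow>
     (\<forall>f Sf g Sg. (f, Sf) \<in> S \<longrightarrow> (g, Sg) \<in> S \<longrightarrow> hinner H Sf g = hinner H f Sg)"

text \<open>For a densely defined operator the following relation is single-valued.\<close>

definition adjoint :: "'a hspace \<Rightarrow> ('a, 'a) operator \<Rightarrow> ('a, 'a) operator" where
  "adjoint H S = {(g, h). g \<in> hcarrier H \<and> h \<in> hcarrier H \<and>
     (\<forall>f Sf. (f, Sf) \<in> S \<longrightarrow> hinner H Sf g = hinner H f h)}"

definition closed_symmetric_operator :: "'a::ab_group_add hspace \<Rightarrow> ('a, 'a) operator \<Rightarrow> bool" where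
  "closed_symmetric_operator H S \<longleftrightarrow>
     linear_operator H H S \<and> densely_defined H S \<and> closed_operator H H S \<and> symmetric_operator H S"

text \<open>The kernel of \<open>S\<^sup>* - z\<close>.\<close>

definition deficiency_space :: "'a hspace \<Rightarrow> ('a, 'a) operator \<Rightarrow> complex \<Rightarrow> 'a set" where
  "deficiency_space H S z = {f. (f, hscale H z f) \<in> adjoint H S}"

text \<open>An orthonormal basis of a closed subspace, as a maximal orthonormal system in it.\<close>

definition orthonormal_basis :: "'a::ab_group_add hspace \<Rightarrow> 'a set \<Rightarrow> 'a set \<Rightarrow> bool" where
  "orthonormal_basis H V B \<longleftrightarrow>
     B \<subseteq> V \<and>
     (\<forall>x\<in>B. \<forall>y\<in>B. hinner H x y = (if x = y then 1 else 0)) \<and>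
     (\<forall>x\<in>V. (\<forall>b\<in>B. hinner H x b = 0) \<longrightarrow> x = 0)"

text \<open>
  The deficiency indices are the Hilbert dimensions, i.e. the cardinalities of orthonormal bases,
  of the kernels of \<open>S\<^sup>* - i\<close> and \<open>S\<^sup>* + i\<close>; they may be arbitrary infinite cardinals.
\<close>

definition equal_deficiency_indices :: "'a::ab_group_add hspace \<Rightarrow> ('a, 'a) operator \<Rightarrow> bool" where
  "equal_deficiency_indices H S \<longleftrightarrow>
     (\<exists>B C. orthonormal_basis H (deficiency_space H S \<i>) B \<and>
            orthonormal_basis H (deficiency_space H S (- \<i>)) C \<and> B \<approx> C)"


section \<open>Boundary triplets\<close>

definition graph_norm :: "'a hspace \<Rightarrow> 'a \<Rightarrow> 'a \<Rightarrow> real" where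
  "graph_norm H f Tf = sqrt ((hnorm H f)\<^sup>2 + (hnorm H Tf)\<^sup>2)"

text \<open>
  \<open>boundary_triplet H S G \<Gamma>\<^sub>0 \<Gamma>\<^sub>1\<close>: \<open>{G, \<Gamma>\<^sub>0, \<Gamma>\<^sub>1}\<close> is an ordinary boundary triplet
  for the adjoint of \<open>S\<close>, including the requirements on \<open>S\<close> itself.
\<close>

definition boundary_triplet ::
    "'a::ab_group_add hspace \<Rightarrow> ('a, 'a) operator \<Rightarrow> 'b::ab_group_add hspace \<Rightarrow>
     ('a, 'b) operator \<Rightarrow> ('a, 'b) operator \<Rightarrow> bool" where
  "boundary_triplet H S G \<Gamma>\<^sub>0 \<Gamma>\<^sub>1 \<longleftrightarrow>
     hilbert_space H \<and> closed_symmetric_operator H S \<and> equal_deficiency_indices H S \<and>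
     hilbert_space G \<and>
     (\<forall>\<Gamma>\<in>{\<Gamma>\<^sub>0, \<Gamma>\<^sub>1}.
        linear_operator H G \<Gamma> \<and> Domain \<Gamma> = Domain (adjoint H S) \<and>
        (\<exists>C. \<forall>f f' h. (f, f') \<in> adjoint H S \<longrightarrow> (f, h) \<in> \<Gamma> \<longrightarrow>
           hnorm G h \<le> C * graph_norm H f f')) \<and>
     (\<forall>f f' g g' f\<^sub>0 f\<^sub>1 g\<^sub>0 g\<^sub>1.
        (f, f') \<in> adjoint H S \<longrightarrow> (g, g') \<in> adjoint H S \<longrightarrow>
        (f, f\<^sub>0) \<in> \<Gamma>\<^sub>0 \<longrightarrow> (f, f\<^sub>1) \<in> \<Gamma>\<^sub>1 \<longrightarrow> (g, g\<^sub>0) \<in> \<Gamma>\<^sub>0 \<longrightarrow> (g, g\<^sub>1) \<in> \<Gamma>\<^sub>1 \<longrightarrow>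
        hinner H f' g - hinner H f g' = hinner G f\<^sub>1 g\<^sub>0 - hinner G f\<^sub>0 g\<^sub>1) \<and>
     (\<forall>h\<^sub>0\<in>hcarrier G. \<forall>h\<^sub>1\<in>hcarrier G. \<exists>f. (f, h\<^sub>0) \<in> \<Gamma>\<^sub>0 \<and> (f, h\<^sub>1) \<in> \<Gamma>\<^sub>1)"

text \<open>
  The operator norm of \<open>\<Gamma>\<close> on the domain of the adjoint of \<open>S\<close> with the graph norm.
\<close>

definition boundary_map_norm ::
    "'a hspace \<Rightarrow> ('a, 'a) operator \<Rightarrow> 'b hspace \<Rightarrow> ('a, 'b) operator \<Rightarrow> ennreal" where
  "boundary_map_norm H S G \<Gamma> =
     (SUP h \<in> {h. \<exists>f f'. (f, f') \<in> adjoint H S \<and> (f, h) \<in> \<Gamma> \<and> graph_norm H f f' \<le> 1}.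
        ennreal (hnorm G h))"


section \<open>Direct sums of operators and boundary triplets\<close>

text \<open>
  Membership of \<open>g\<close> in the direct sum of the target spaces is the square summability condition
  in the domain of the direct sum of operators.
\<close>

definition dsum_operator ::
    "(nat \<Rightarrow> 'a hspace) \<Rightarrow> (nat \<Rightarrow> 'b hspace) \<Rightarrow> (nat \<Rightarrow> ('a, 'b) operator) \<Rightarrow>
     (nat \<Rightarrow> 'a, nat \<Rightarrow> 'b) operator" where
  "dsum_operator H K T =
     {(f, g). f \<in> hcarrier (hdsum H) \<and> g \<in> hcarrier (hdsum K) \<and> (\<forall>n. (f n, g n) \<in> T n)}"

lemma Domain_dsum_operator:
  assumes "\<And>n. linear_operator (H n) (K n) (T n)"
  shows "Domain (dsum_operator H K T) =
    {f \<in> hcarrier (hdsum H). (\<forall>n. f n \<in> Domain (T n)) \<and>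
       summable (\<lambda>n. (hnorm (K n) (THE g. (f n, g) \<in> T n))\<^sup>2)}"
proof -
  have The: "(THE g. (x, g) \<in> T n) = y" if "(x, y) \<in> T n" for n x y
    using assms[of n] that by (auto simp: linear_operator_def single_valued_def)
  show ?thesis
  proof (intro equalityI subsetI)
    fix f assume "f \<in> Domain (dsum_operator H K T)"
    then obtain g where "f \<in> hcarrier (hdsum H)" "g \<in> hcarrier (hdsum K)" "\<And>n. (f n, g n) \<in> T n"
      by (auto simp: dsum_operator_def)
    moreover from this have "(\<lambda>n. THE g. (f n, g) \<in> T n) = g"
      using The by blast
    ultimately show "f \<in> {f \<in> hcarrier (hdsum H). (\<forall>n. f n \<in> Domain (T n)) \<and>
       summable (\<lambda>n. (hnorm (K n) (THE g. (f n, g) \<in> T n))\<^sup>2)}"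
      by (auto simp: hdsum_def fun_eq_iff)
  next
    fix f assume f: "f \<in> {f \<in> hcarrier (hdsum H). (\<forall>n. f n \<in> Domain (T n)) \<and>
       summable (\<lambda>n. (hnorm (K n) (THE g. (f n, g) \<in> T n))\<^sup>2)}"
    define g where "g = (\<lambda>n. THE g. (f n, g) \<in> T n)"
    have g: "(f n, g n) \<in> T n" for n
      using f The unfolding g_def by force
    moreover have "g n \<in> hcarrier (K n)" for n
      using g assms[of n] by (auto simp: linear_operator_def)
    ultimately have "(f, g) \<in> dsum_operator H K T"
      using f by (auto simp: dsum_operator_def hdsum_def g_def)
    then show "f \<in> Domain (dsum_operator H K T)" by blast
  qed
qed

lemma adjoint_dsum_operator:
  assumes H: "\<And>n. hilbert_space (H n)" and S: "\<And>n. linear_operator (H n) (H n) (S n)"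
  shows "adjoint (hdsum H) (dsum_operator H H S) = dsum_operator H H (\<lambda>n. adjoint (H n) (S n))"
proof (intro equalityI subrelI)
  fix g h assume gh: "(g, h) \<in> adjoint (hdsum H) (dsum_operator H H S)"
  then have car: "g \<in> hcarrier (hdsum H)" "h \<in> hcarrier (hdsum H)"
    by (auto simp: adjoint_def)
  have z: "hinner (H n) 0 x = 0" if "x \<in> hcarrier (H n)" for n x
  proof -
    interpret hilbert_space "H n" by (rule H)
    show ?thesis using inner_add_left[of 0 0 x] that subspace_carrier by (auto simp: subspace_0)
  qed
  have "(g n, h n) \<in> adjoint (H n) (S n)" for n
  proof -
    have "hinner (H n) v (g n) = hinner (H n) u (h n)" if uv: "(u, v) \<in> S n" for u v
    proof -
      define e where "e = (\<lambda>x m. if m = n then x else 0 :: 'a)"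
      have e_in: "e x \<in> hcarrier (hdsum H)" if "x \<in> hcarrier (H n)" for x
      proof -
        have "0 \<in> hcarrier (H m)" for m
          using S[of m] by (auto simp: linear_operator_def)
        then have "hnorm (H m) 0 = 0" for m
          by (simp add: hnorm_def z)
        then have "summable (\<lambda>m. (hnorm (H m) (e x m))\<^sup>2)"
          by (intro summable_finite[of "{n}"]) (auto simp: e_def)
        then show ?thesis
          using that \<open>\<And>m. 0 \<in> hcarrier (H m)\<close> by (auto simp: hdsum_def e_def)
      qed
      have "(e u, e v) \<in> dsum_operator H H S"
      proof -
        have "u \<in> hcarrier (H n)" "v \<in> hcarrier (H n)" "\<And>m. (0, 0) \<in> S m"
          using uv S unfolding linear_operator_def by blast+
        then have "\<And>m. (e u m, e v m) \<in> S m" "e u \<in> hcarrier (hdsum H)" "e v \<in> hcarrier (hdsum H)"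
          using uv e_in by (simp_all add: e_def)
        then show ?thesis by (simp add: dsum_operator_def)
      qed
      moreover have "hinner (hdsum H) (e x) y = hinner (H n) x (y n)"
        if "y \<in> hcarrier (hdsum H)" for x y
      proof -
        have "hinner (H m) (e x m) (y m) = 0" if "m \<notin> {n}" for m
          using that z \<open>y \<in> hcarrier (hdsum H)\<close> by (auto simp: e_def hdsum_def)
        then have "(\<Sum>m. hinner (H m) (e x m) (y m)) = (\<Sum>m\<in>{n}. hinner (H m) (e x m) (y m))"
          by (intro suminf_finite) auto
        then show ?thesis by (simp add: hdsum_def e_def)
      qed
      moreover from calculation(1) have "hinner (hdsum H) (e v) g = hinner (hdsum H) (e u) h"
        using gh by (simp add: adjoint_def)
      ultimately show ?thesis
        using car by metis
    qed
    then show ?thesis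
      using car by (auto simp: adjoint_def hdsum_def)
  qed
  then show "(g, h) \<in> dsum_operator H H (\<lambda>n. adjoint (H n) (S n))"
    using car by (simp add: dsum_operator_def)
next
  fix g h assume gh: "(g, h) \<in> dsum_operator H H (\<lambda>n. adjoint (H n) (S n))"
  have "hinner (hdsum H) v g = hinner (hdsum H) u h" if "(u, v) \<in> dsum_operator H H S" for u v
  proof -
    have "hinner (H n) (v n) (g n) = hinner (H n) (u n) (h n)" for n
      using gh that by (auto simp: dsum_operator_def adjoint_def)
    then show ?thesis by (simp add: hdsum_def)
  qed
  then show "(g, h) \<in> adjoint (hdsum H) (dsum_operator H H S)"
    using gh by (auto simp: adjoint_def dsum_operator_def)
qed

text \<open>
  The direct sum of boundary maps is a priori defined only on a part of the domain of the direct
  sum of the adjoints.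
\<close>

definition dsum_boundary_map ::
    "(nat \<Rightarrow> 'a hspace) \<Rightarrow> (nat \<Rightarrow> ('a, 'a) operator) \<Rightarrow> (nat \<Rightarrow> 'b hspace) \<Rightarrow>
     (nat \<Rightarrow> ('a, 'b) operator) \<Rightarrow> (nat \<Rightarrow> 'a, nat \<Rightarrow> 'b) operator" where
  "dsum_boundary_map H S G \<Gamma> =
     {(f, h) \<in> dsum_operator H G \<Gamma>. f \<in> Domain (dsum_operator H H (\<lambda>n. adjoint (H n) (S n)))}"

end

theory Submission
  imports Defs "HOL-Library.Product_Plus"
begin

text \<open>
  A bound for the boundary maps of the direct sum restricts to the summands, which gives necessity.
  For sufficiency, uniform bounds make the maps everywhere defined and bounded, and the remaining
  point is joint surjectivity, i.e. a uniform bound for right inverses of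
  \<open>\<Gamma> = {\<Gamma>\<^sub>0, \<Gamma>\<^sub>1}\<close>. Since \<open>\<Gamma>\<close> vanishes on \<open>dom S\<close>, every boundary value is attained at some \<open>u\<close>
  orthogonal to \<open>dom S\<close> in the graph inner product, i.e. with \<open>S\<^sup>* S\<^sup>* u = - u\<close>. Green's identity for
  \<open>u\<close> and \<open>v = S\<^sup>* u\<close> then reads
  \<open>\<parallel>u\<parallel>\<^sup>2 + \<parallel>v\<parallel>\<^sup>2 = (\<Gamma>\<^sub>1 u, \<Gamma>\<^sub>0 v) - (\<Gamma>\<^sub>0 u, \<Gamma>\<^sub>1 v)\<close>. As \<open>u\<close> and \<open>v\<close> have the same graph norm, a bound
  \<open>C\<close> for \<open>\<Gamma>\<^sub>0\<close> and \<open>\<Gamma>\<^sub>1\<close> bounds that graph norm by \<open>C (\<parallel>\<Gamma>\<^sub>0 u\<parallel> + \<parallel>\<Gamma>\<^sub>1 u\<parallel>)\<close>.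
\<close>

section \<open>Hilbert spaces with an explicit carrier\<close>

context hilbert_space
begin

lemma carrier_zero: "0 \<in> hcarrier H"
  and carrier_add: "\<lbrakk>x \<in> hcarrier H; y \<in> hcarrier H\<rbrakk> \<Longrightarrow> x + y \<in> hcarrier H"
  and carrier_scale: "x \<in> hcarrier H \<Longrightarrow> hscale H c x \<in> hcarrier H"
  and carrier_diff: "\<lbrakk>x \<in> hcarrier H; y \<in> hcarrier H\<rbrakk> \<Longrightarrow> x - y \<in> hcarrier H"
  and carrier_uminus: "x \<in> hcarrier H \<Longrightarrow> - x \<in> hcarrier H"
  using subspace_carrier by (auto intro: subspace_0 subspace_add subspace_scale subspace_diff subspace_neg)

lemmas carrier_closed = carrier_zero carrier_add carrier_scale carrier_diff carrier_uminus

lemma inner_zero_left: "x \<in> hcarrier H \<Longrightarrow> hinner H 0 x = 0"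
  using inner_add_left[of 0 0 x] by (simp add: carrier_closed)

lemma inner_zero_right: "x \<in> hcarrier H \<Longrightarrow> hinner H x 0 = 0"
  using inner_commute[of 0 x] by (simp add: carrier_closed inner_zero_left)

lemma inner_add_right:
  "\<lbrakk>x \<in> hcarrier H; y \<in> hcarrier H; z \<in> hcarrier H\<rbrakk>
    \<Longrightarrow> hinner H x (y + z) = hinner H x y + hinner H x z"
  by (metis carrier_add complex_cnj_add inner_add_left inner_commute)

lemma inner_scale_right:
  "\<lbrakk>x \<in> hcarrier H; y \<in> hcarrier H\<rbrakk> \<Longrightarrow> hinner H x (hscale H c y) = cnj c * hinner H x y"
  by (metis carrier_scale complex_cnj_mult inner_scale_left inner_commute)

lemma inner_minus_left: "\<lbrakk>x \<in> hcarrier H; y \<in> hcarrier H\<rbrakk> \<Longrightarrow> hinner H (- x) y = - hinner H x y"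
  using inner_add_left[of x "- x" y] by (simp add: carrier_closed inner_zero_left eq_neg_iff_add_eq_0 add.commute)

lemma inner_minus_right: "\<lbrakk>x \<in> hcarrier H; y \<in> hcarrier H\<rbrakk> \<Longrightarrow> hinner H x (- y) = - hinner H x y"
  by (metis carrier_uminus complex_cnj_minus inner_minus_left inner_commute)

lemma inner_diff_left:
  "\<lbrakk>x \<in> hcarrier H; y \<in> hcarrier H; z \<in> hcarrier H\<rbrakk>
    \<Longrightarrow> hinner H (x - y) z = hinner H x z - hinner H y z"
  using inner_add_left[of x "- y" z] by (simp add: carrier_closed inner_minus_left)

lemma inner_diff_right:
  "\<lbrakk>x \<in> hcarrier H; y \<in> hcarrier H; z \<in> hcarrier H\<rbrakk>
    \<Longrightarrow> hinner H x (y - z) = hinner H x y - hinner H x z"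
  using inner_add_right[of x y "- z"] by (simp add: carrier_closed inner_minus_right)

lemmas inner_simps = inner_zero_left inner_zero_right inner_add_left inner_add_right
  inner_scale_left inner_scale_right inner_minus_left inner_minus_right
  inner_diff_left inner_diff_right

lemma hnorm_nonneg: "0 \<le> hnorm H x" if "x \<in> hcarrier H"
  using inner_nonneg[OF that] by (simp add: hnorm_def)

lemma hnorm_square: "(hnorm H x)\<^sup>2 = Re (hinner H x x)" if "x \<in> hcarrier H"
  using inner_nonneg[OF that] by (simp add: hnorm_def)

lemma inner_self: "hinner H x x = of_real ((hnorm H x)\<^sup>2)" if "x \<in> hcarrier H"
  using inner_commute[OF that that] hnorm_square[OF that] by (simp add: complex_eq_iff)

lemma hnorm_zero: "hnorm H 0 = 0"
  by (simp add: hnorm_def inner_zero_left carrier_zero)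

lemma hnorm_eq_zero: "hnorm H x = 0 \<longleftrightarrow> x = 0" if "x \<in> hcarrier H"
  using inner_eq_zeroD[OF that] inner_self[OF that] by (auto simp: hnorm_zero)

lemma hnorm_scale: "hnorm H (hscale H c x) = cmod c * hnorm H x" if "x \<in> hcarrier H"
proof (rule power2_eq_imp_eq)
  have "hinner H (hscale H c x) (hscale H c x) = (c * cnj c) * hinner H x x"
    using that by (simp add: inner_simps carrier_closed)
  also have "\<dots> = of_real ((cmod c)\<^sup>2 * (hnorm H x)\<^sup>2)"
    by (simp only: complex_norm_square inner_self[OF that] of_real_mult)
  finally show "(hnorm H (hscale H c x))\<^sup>2 = (cmod c * hnorm H x)\<^sup>2"
    using that by (simp add: hnorm_square[of "hscale H c x"] carrier_closed power_mult_distrib)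
qed (use that in \<open>auto simp: hnorm_nonneg carrier_closed\<close>)

lemma hnorm_uminus: "hnorm H (- x) = hnorm H x" if "x \<in> hcarrier H"
  using that by (simp add: hnorm_def inner_simps carrier_closed)

lemma hnorm_minus_commute: "hnorm H (x - y) = hnorm H (y - x)"
  if "x \<in> hcarrier H" "y \<in> hcarrier H"
  using hnorm_uminus[of "x - y"] that by (simp add: carrier_closed)

lemma hnorm_add_square:
  "(hnorm H (x + y))\<^sup>2 = (hnorm H x)\<^sup>2 + (hnorm H y)\<^sup>2 + 2 * Re (hinner H x y)"
  if "x \<in> hcarrier H" "y \<in> hcarrier H"
  using that inner_commute[of x y] by (simp add: hnorm_square carrier_closed inner_simps)

lemma hnorm_diff_square:
  "(hnorm H (x - y))\<^sup>2 = (hnorm H x)\<^sup>2 + (hnorm H y)\<^sup>2 - 2 * Re (hinner H x y)"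
  if "x \<in> hcarrier H" "y \<in> hcarrier H"
  using that inner_commute[of x y] by (simp add: hnorm_square carrier_closed inner_simps)

text \<open>Cauchy-Schwarz, from the nonnegative squared norm of \<open>q\<^sup>2 x - a y\<close>
  with \<open>a = (x, y)\<close> and \<open>q\<close> the norm of \<open>y\<close>. Scaling
  \<open>x\<close> by \<open>q\<^sup>2\<close> avoids dividing by \<open>q\<^sup>2\<close>;
  expanding leaves a positive factor times the desired difference.\<close>

lemma cmod_inner_le: "cmod (hinner H x y) \<le> hnorm H x * hnorm H y"
  if x: "x \<in> hcarrier H" and y: "y \<in> hcarrier H"
proof (cases "y = 0")
  case True
  then show ?thesis using x by (simp add: inner_zero_right hnorm_zero)
next
  case False
  define a where "a = hinner H x y"
  define p q where "p = hnorm H x" and "q = hnorm H y"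
  have q: "q > 0" using False y hnorm_nonneg[OF y] hnorm_eq_zero[OF y] by (simp add: q_def)
  have "0 \<le> (hnorm H (hscale H (of_real (q\<^sup>2)) x - hscale H a y))\<^sup>2" by simp
  also have "\<dots> = q ^ 4 * p\<^sup>2 + (cmod a)\<^sup>2 * q\<^sup>2 - 2 * (q\<^sup>2 * (cmod a)\<^sup>2)"
  proof -
    have "hinner H (hscale H (of_real (q\<^sup>2)) x) (hscale H a y) = of_real (q\<^sup>2) * (a * cnj a)"
      using x y by (simp add: carrier_closed inner_simps flip: a_def)
    also have "\<dots> = of_real (q\<^sup>2 * (cmod a)\<^sup>2)"
      by (simp only: complex_norm_square of_real_mult)
    finally show ?thesis
      using x y by (simp add: hnorm_diff_square carrier_closed hnorm_scale power_mult_distrib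
          norm_mult norm_power flip: p_def q_def)
  qed
  also have "\<dots> = q\<^sup>2 * ((p * q)\<^sup>2 - (cmod a)\<^sup>2)"
    by (simp add: algebra_simps power_mult_distrib flip: power_add)
  finally have "(cmod a)\<^sup>2 \<le> (p * q)\<^sup>2"
    using q by (simp add: zero_le_mult_iff)
  then show ?thesis
    using power2_le_imp_le[of "cmod a" "p * q"] hnorm_nonneg x y by (simp add: a_def p_def q_def)
qed

lemma hnorm_triangle: "hnorm H (x + y) \<le> hnorm H x + hnorm H y"
  if x: "x \<in> hcarrier H" and y: "y \<in> hcarrier H"
proof (rule power2_le_imp_le)
  have "Re (hinner H x y) \<le> hnorm H x * hnorm H y"
    using cmod_inner_le[OF that] complex_Re_le_cmod order_trans by blast
  then show "(hnorm H (x + y))\<^sup>2 \<le> (hnorm H x + hnorm H y)\<^sup>2"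
    using that by (simp add: hnorm_add_square power2_sum)
qed (use that in \<open>auto simp: hnorm_nonneg\<close>)

lemma hnorm_diff_triangle: "hnorm H (x - z) \<le> hnorm H (x - y) + hnorm H (y - z)"
  if "x \<in> hcarrier H" "y \<in> hcarrier H" "z \<in> hcarrier H"
  using hnorm_triangle[of "x - y" "y - z"] that by (simp add: carrier_closed)

text \<open>The parallelogram law with the term for \<open>x - y\<close> dropped. Its squared form
  makes square summability stable under addition.\<close>

lemma hnorm_add_square_le: "(hnorm H (x + y))\<^sup>2 \<le> 2 * (hnorm H x)\<^sup>2 + 2 * (hnorm H y)\<^sup>2"
  if "x \<in> hcarrier H" "y \<in> hcarrier H"
proof -
  have "0 \<le> (hnorm H (x - y))\<^sup>2" by simp
  then show ?thesis using that by (simp add: hnorm_add_square hnorm_diff_square)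
qed

text \<open>Continuity of the norm. As the ambient space carries no topology, convergence is
  expressed through \<open>hnorm\<close>, and the reverse triangle inequality is applied by
  hand.\<close>

lemma LIMSEQ_hnorm_diff: "(\<lambda>n. hnorm H (X n - z)) \<longlonglongrightarrow> hnorm H (x - z)"
  if X: "\<And>n. X n \<in> hcarrier H" and x: "x \<in> hcarrier H" and z: "z \<in> hcarrier H"
    and lim: "(\<lambda>n. hnorm H (X n - x)) \<longlonglongrightarrow> 0"
proof -
  have "\<bar>hnorm H (X n - z) - hnorm H (x - z)\<bar> \<le> hnorm H (X n - x)" for n
    using hnorm_diff_triangle[of "X n" x z] hnorm_diff_triangle[of x "X n" z]
      hnorm_minus_commute[of x "X n"] X x z by (simp add: abs_le_iff)
  then have "(\<lambda>n. hnorm H (X n - z) - hnorm H (x - z)) \<longlonglongrightarrow> 0"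
    by (intro tendsto_rabs_zero_cancel[OF tendsto_sandwich[OF _ _ tendsto_const lim]] always_eventually) auto
  then show ?thesis by (simp add: LIM_zero_iff)
qed

text \<open>The projection theorem for a sequentially closed subspace: a minimizing sequence for the
  distance is Cauchy by the parallelogram law, and its limit is a minimizer, where the first
  variation has to vanish.\<close>

lemma orthogonal_decomposition:
  assumes V: "subspace V" "V \<subseteq> hcarrier H"
    and closed: "\<And>X v. \<lbrakk>\<And>n::nat. X n \<in> V; v \<in> hcarrier H; (\<lambda>n. hnorm H (X n - v)) \<longlonglongrightarrow> 0\<rbrakk> \<Longrightarrow> v \<in> V"
    and x: "x \<in> hcarrier H"
  obtains v where "v \<in> V" "\<And>w. w \<in> V \<Longrightarrow> hinner H w (x - v) = 0"
proof -
  \<comment> \<open>The infimum \<open>d\<close> is the squared distance from \<open>x\<close> to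
    \<open>V\<close>.\<close>
  define D where "D = (\<lambda>v. (hnorm H (x - v))\<^sup>2) ` V"
  define d where "d = Inf D"
  have "0 \<in> V" using V by (simp add: subspace_0)
  then have D: "D \<noteq> {}" "bdd_below D" by (auto simp: D_def intro!: bdd_belowI[of _ 0])
  have d_le: "d \<le> (hnorm H (x - v))\<^sup>2" if "v \<in> V" for v
    using that D unfolding d_def by (intro cInf_lower) (auto simp: D_def)
  have "\<exists>v\<in>V. (hnorm H (x - v))\<^sup>2 < d + 1 / real (Suc n)" for n
    using cInf_lessD[OF D(1), of "d + 1 / real (Suc n)"] by (auto simp: d_def D_def)
  then obtain X where X: "\<And>n. X n \<in> V"
    and X_d: "\<And>n. (hnorm H (x - X n))\<^sup>2 < d + 1 / real (Suc n)" by metis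
  have X_mem: "X n \<in> hcarrier H" for n using X V by auto
  have bound: "(hnorm H (X m - X n))\<^sup>2 \<le> 2 / real (Suc m) + 2 / real (Suc n)" for m n
  proof -
    \<comment> \<open>The midpoint of \<open>X m\<close> and \<open>X n\<close> is again in
      \<open>V\<close>, so the sum of \<open>x - X m\<close> and \<open>x - X n\<close> has squared
      norm at least \<open>4 * d\<close>. The parallelogram law leaves only the two error terms for
      their difference.\<close>
    define w where "w = hscale H (1 / 2) (X m + X n)"
    have w: "w \<in> V" using X V by (auto simp: w_def intro!: subspace_scale subspace_add)
    have "hscale H 2 (x - w) = (x - X m) + (x - X n)"
      by (simp add: w_def scale_right_diff_distrib scale_left_distrib[of 1 1, simplified])
    then have "(hnorm H ((x - X m) + (x - X n)))\<^sup>2 = (2 * hnorm H (x - w))\<^sup>2"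
      using hnorm_scale[of "x - w" 2] x w V by (auto simp: carrier_closed)
    then have "4 * d \<le> (hnorm H ((x - X m) + (x - X n)))\<^sup>2"
      using d_le[OF w] by (simp add: power_mult_distrib)
    moreover have "(x - X n) - (x - X m) = X m - X n" by simp
    ultimately show ?thesis
      using hnorm_add_square[of "x - X n" "x - X m"] hnorm_diff_square[of "x - X n" "x - X m"]
        X_d[of m] X_d[of n] x X_mem by (simp add: carrier_closed add.commute)
  qed
  have "\<forall>e>0. \<exists>N. \<forall>m\<ge>N. \<forall>n\<ge>N. hnorm H (X m - X n) < e"
  proof (intro allI impI)
    fix e :: real assume "0 < e"
    then obtain N where N: "1 / real (Suc N) < e\<^sup>2 / 4"
      using nat_approx_posE[of "e\<^sup>2 / 4"] by auto
    have "hnorm H (X m - X n) < e" if "m \<ge> N" "n \<ge> N" for m n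
    proof (rule power2_less_imp_less)
      have "1 / real (Suc m) \<le> 1 / real (Suc N)" "1 / real (Suc n) \<le> 1 / real (Suc N)"
        using that by (auto intro!: divide_left_mono)
      then show "(hnorm H (X m - X n))\<^sup>2 < e\<^sup>2"
        using bound[of m n] N by linarith
    qed (use \<open>0 < e\<close> in simp)
    then show "\<exists>N. \<forall>m\<ge>N. \<forall>n\<ge>N. hnorm H (X m - X n) < e" by blast
  qed
  then obtain v where v: "v \<in> hcarrier H" and lim: "(\<lambda>n. hnorm H (X n - v)) \<longlonglongrightarrow> 0"
    using complete[of X] X_mem by blast
  have vV: "v \<in> V" using closed X v lim by blast
  have "(\<lambda>n. hnorm H (x - X n)) \<longlonglongrightarrow> hnorm H (x - v)"
    using LIMSEQ_hnorm_diff[OF X_mem v x lim] hnorm_minus_commute x v X_mem by simp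
  then have "(\<lambda>n. (hnorm H (x - X n))\<^sup>2) \<longlonglongrightarrow> (hnorm H (x - v))\<^sup>2"
    by (intro tendsto_power)
  \<comment> \<open>Passing to the limit in \<open>X_d\<close> shows that \<open>v\<close> attains
    the infimum.\<close>
  from LIMSEQ_le[OF this, of "\<lambda>n. d + 1 / real (Suc n)" "d + 0"]
  have v_le: "(hnorm H (x - v))\<^sup>2 \<le> d"
    using X_d less_imp_le LIMSEQ_inverse_real_of_nat_add[of d] unfolding inverse_eq_divide by simp blast
  have "hinner H w (x - v) = 0" if w: "w \<in> V" for w
  proof -
    define a where "a = hinner H (x - v) w"
    \<comment> \<open>Moving \<open>v\<close> by \<open>t * a\<close> along \<open>w\<close> changes
      the squared distance by \<open>t * (cmod a)\<^sup>2\<close> times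
      \<open>t * (hnorm H w)\<^sup>2 - 2\<close>. This \<open>t\<close> makes the second factor
      negative, so minimality forces \<open>a = 0\<close>; the summand 1 keeps the denominator
      positive when \<open>w = 0\<close>.\<close>
    define t where "t = 1 / ((hnorm H w)\<^sup>2 + 1)"
    have w': "w \<in> hcarrier H" using w V by auto
    have t: "t > 0" "t * (hnorm H w)\<^sup>2 \<le> 1"
      using add_nonneg_pos[OF zero_le_power2[of "hnorm H w"] zero_less_one] by (auto simp: t_def field_simps)
    have "v + hscale H (of_real t * a) w \<in> V"
      using V vV w by (auto intro!: subspace_add subspace_scale)
    from d_le[OF this] have "d \<le> (hnorm H ((x - v) - hscale H (of_real t * a) w))\<^sup>2"
      by (simp add: diff_diff_eq)
    also have "\<dots> = (hnorm H (x - v))\<^sup>2 + t\<^sup>2 * (cmod a)\<^sup>2 * (hnorm H w)\<^sup>2 - 2 * (t * (cmod a)\<^sup>2)"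
    proof -
      have "hinner H (x - v) (hscale H (of_real t * a) w) = of_real t * (a * cnj a)"
        using x v w' by (simp add: carrier_closed inner_scale_right flip: a_def)
      also have "\<dots> = of_real (t * (cmod a)\<^sup>2)"
        by (simp only: complex_norm_square of_real_mult)
      finally show ?thesis
        using x v w' by (simp add: hnorm_diff_square carrier_closed hnorm_scale
            power_mult_distrib norm_mult)
    qed
    finally have "0 \<le> (t * (cmod a)\<^sup>2) * (t * (hnorm H w)\<^sup>2 - 2)"
      using v_le by (simp add: algebra_simps power2_eq_square)
    moreover have "t * (hnorm H w)\<^sup>2 - 2 < 0" using t by simp
    ultimately have "t * (cmod a)\<^sup>2 \<le> 0"
      by (metis mult_pos_neg not_le)
    then have "a = 0" using t by (simp add: mult_le_0_iff)
    then show ?thesis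
      using inner_commute[of "x - v" w] x v w' by (simp add: a_def carrier_closed)
  qed
  with vV show thesis by (rule that)
qed

end

section \<open>The orthogonal sum of two Hilbert spaces, in which operator graphs live\<close>

definition hprod :: "'a hspace \<Rightarrow> 'b hspace \<Rightarrow> ('a \<times> 'b) hspace" where
  "hprod H K =
    \<lparr>hcarrier = hcarrier H \<times> hcarrier K,
     hscale = (\<lambda>c p. (hscale H c (fst p), hscale K c (snd p))),
     hinner = (\<lambda>p q. hinner H (fst p) (fst q) + hinner K (snd p) (snd q))\<rparr>"

lemma hprod_simps:
  "p \<in> hcarrier (hprod H K) \<longleftrightarrow> fst p \<in> hcarrier H \<and> snd p \<in> hcarrier K"
  "hscale (hprod H K) c p = (hscale H c (fst p), hscale K c (snd p))"
  "hinner (hprod H K) p q = hinner H (fst p) (fst q) + hinner K (snd p) (snd q)"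
  by (simp_all add: hprod_def mem_Times_iff)

text \<open>Completeness is inherited coordinatewise: both coordinate norms are dominated by the
  product norm, so a Cauchy sequence has Cauchy coordinates, and their limits form the limit
  pair.\<close>

lemma hilbert_space_hprod:
  assumes "hilbert_space H" "hilbert_space K"
  shows "hilbert_space (hprod H K)"
proof -
  interpret H: hilbert_space H by fact
  interpret K: hilbert_space K by fact
  have vs: "vector_space (hscale (hprod H K))"
    by unfold_locales (auto simp: hprod_simps prod_eq_iff H.scale_right_distrib H.scale_left_distrib
        K.scale_right_distrib K.scale_left_distrib)
  then interpret vector_space "hscale (hprod H K)" .
  have norm: "hnorm (hprod H K) p = sqrt ((hnorm H (fst p))\<^sup>2 + (hnorm K (snd p))\<^sup>2)"
    if "p \<in> hcarrier (hprod H K)" for p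
    using that by (simp add: hprod_simps hnorm_def[of "hprod H K"] H.hnorm_square K.hnorm_square)
  have sub: "subspace (hcarrier (hprod H K))"
    by (auto simp: subspace_def hprod_simps H.carrier_closed K.carrier_closed)
  show ?thesis
  proof (intro hilbert_space.intro hilbert_space_axioms.intro vs sub)
    fix p assume p: "p \<in> hcarrier (hprod H K)" "hinner (hprod H K) p p = 0"
    then have "Re (hinner (hprod H K) p p) = 0" by simp
    then have "(hnorm H (fst p))\<^sup>2 + (hnorm K (snd p))\<^sup>2 = 0"
      using p(1) by (simp add: hprod_simps H.hnorm_square K.hnorm_square)
    then show "p = 0"
      using p(1) by (auto simp: sum_power2_eq_zero_iff H.hnorm_eq_zero K.hnorm_eq_zero hprod_simps prod_eq_iff)
  next
    fix X :: "nat \<Rightarrow> _"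
    assume X: "\<And>n. X n \<in> hcarrier (hprod H K)"
      and C: "\<forall>e>0. \<exists>N. \<forall>m\<ge>N. \<forall>n\<ge>N. hnorm (hprod H K) (X m - X n) < e"
    have X': "fst (X n) \<in> hcarrier H" "snd (X n) \<in> hcarrier K" for n
      using X[of n] by (auto simp: hprod_simps)
    have "hnorm H (fst (X m) - fst (X n)) \<le> hnorm (hprod H K) (X m - X n)"
      and "hnorm K (snd (X m) - snd (X n)) \<le> hnorm (hprod H K) (X m - X n)" for m n
      using norm[of "X m - X n"] X[of m] X[of n] subspace_diff[OF sub] by (simp_all add: real_le_rsqrt)
    then have "\<forall>e>0. \<exists>N. \<forall>m\<ge>N. \<forall>n\<ge>N. hnorm H (fst (X m) - fst (X n)) < e"
      and "\<forall>e>0. \<exists>N. \<forall>m\<ge>N. \<forall>n\<ge>N. hnorm K (snd (X m) - snd (X n)) < e"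
      using C order_le_less_trans by (metis (no_types, lifting))+
    then obtain x y where x: "x \<in> hcarrier H" "(\<lambda>n. hnorm H (fst (X n) - x)) \<longlonglongrightarrow> 0"
      and y: "y \<in> hcarrier K" "(\<lambda>n. hnorm K (snd (X n) - y)) \<longlonglongrightarrow> 0"
      using H.complete[of "\<lambda>n. fst (X n)"] K.complete[of "\<lambda>n. snd (X n)"] X' by blast
    have "(\<lambda>n. sqrt ((hnorm H (fst (X n) - x))\<^sup>2 + (hnorm K (snd (X n) - y))\<^sup>2)) \<longlonglongrightarrow> sqrt (0\<^sup>2 + 0\<^sup>2)"
      using x y by (intro tendsto_intros)
    moreover have "hnorm (hprod H K) (X n - (x, y)) =
        sqrt ((hnorm H (fst (X n) - x))\<^sup>2 + (hnorm K (snd (X n) - y))\<^sup>2)" for n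
      using norm[of "X n - (x, y)"] X' x y by (simp add: hprod_simps H.carrier_closed K.carrier_closed)
    ultimately show "\<exists>p\<in>hcarrier (hprod H K). (\<lambda>n. hnorm (hprod H K) (X n - p)) \<longlonglongrightarrow> 0"
      using x y by (intro bexI[of _ "(x, y)"]) (auto simp: hprod_simps)
  next
    fix p q assume "p \<in> hcarrier (hprod H K)" "q \<in> hcarrier (hprod H K)"
    then show "hinner (hprod H K) q p = cnj (hinner (hprod H K) p q)"
      using H.inner_commute[of "fst p" "fst q"] K.inner_commute[of "snd p" "snd q"]
      by (simp add: hprod_simps)
  next
    fix p assume "p \<in> hcarrier (hprod H K)"
    then show "0 \<le> Re (hinner (hprod H K) p p)"
      using H.inner_nonneg[of "fst p"] K.inner_nonneg[of "snd p"] by (simp add: hprod_simps)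
  qed (auto simp: hprod_simps H.inner_simps K.inner_simps algebra_simps)
qed

section \<open>Boundary triplets and the graph decomposition\<close>

lemma linear_operatorD:
  assumes "linear_operator H K T"
  shows "(f, g) \<in> T \<Longrightarrow> f \<in> hcarrier H" "(f, g) \<in> T \<Longrightarrow> g \<in> hcarrier K"
    and "\<lbrakk>(f, g) \<in> T; (f, g') \<in> T\<rbrakk> \<Longrightarrow> g = g'" "(0, 0) \<in> T"
    and "\<lbrakk>(f, g) \<in> T; (f', g') \<in> T\<rbrakk> \<Longrightarrow> (f + f', g + g') \<in> T"
    and "(f, g) \<in> T \<Longrightarrow> (hscale H c f, hscale K c g) \<in> T"
  using assms unfolding linear_operator_def single_valued_def by blast+

lemma linear_operator_diff:
  assumes "hilbert_space H" "hilbert_space K" "linear_operator H K T" "(f, g) \<in> T" "(f', g') \<in> T"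
  shows "(f - f', g - g') \<in> T"
proof -
  interpret H: hilbert_space H by fact
  interpret K: hilbert_space K by fact
  have "(f + hscale H (-1) f', g + hscale K (-1) g') \<in> T"
    using assms(3-5) by (blast intro: linear_operatorD)
  then show ?thesis by simp
qed

lemma symmetric_subset_adjoint:
  assumes "closed_symmetric_operator H S"
  shows "S \<subseteq> adjoint H S"
  using assms
  by (force simp: closed_symmetric_operator_def symmetric_operator_def linear_operator_def adjoint_def)

context hilbert_space
begin

lemma scale_adjoint: "(f, f') \<in> adjoint H S \<Longrightarrow> (hscale H c f, hscale H c f') \<in> adjoint H S"
  if "S \<subseteq> hcarrier H \<times> hcarrier H"
  using that by (force simp: adjoint_def carrier_closed inner_simps)

lemma graph_norm_scale:
  "graph_norm H (hscale H c f) (hscale H c f') = cmod c * graph_norm H f f'"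
  if "f \<in> hcarrier H" "f' \<in> hcarrier H"
  using that by (simp add: graph_norm_def hnorm_scale power_mult_distrib real_sqrt_mult flip: distrib_left)

text \<open>
  The graph of \<open>S\<close> is closed in \<open>H \<oplus> H\<close>, and \<open>(u, v)\<close> is orthogonal to it iff \<open>S\<^sup>* v = - u\<close>.
\<close>

lemma adjoint_decomposition:
  assumes S: "closed_symmetric_operator H S" and f: "(f, f') \<in> adjoint H S"
  obtains u v where "(u, v) \<in> adjoint H S" "(v, - u) \<in> adjoint H S" "(f - u, f' - v) \<in> S"
proof -
  interpret P: hilbert_space "hprod H H"
    using hilbert_space_hprod hilbert_space_axioms by blast
  have lin: "linear_operator H H S" and cl: "closed_operator H H S"
    using S by (auto simp: closed_symmetric_operator_def)
  note S_mem = linear_operatorD(1,2)[OF lin]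
  have ff': "f \<in> hcarrier H" "f' \<in> hcarrier H" using f by (auto simp: adjoint_def)
  \<comment> \<open>This turns convergence in the product into the convergence of arguments and of
    values that \<open>closed_operator\<close> asks for.\<close>
  have norm_le: "hnorm H (fst p) \<le> hnorm (hprod H H) p" "hnorm H (snd p) \<le> hnorm (hprod H H) p"
    if "fst p \<in> hcarrier H" "snd p \<in> hcarrier H" for p
    using that inner_nonneg by (simp_all add: hnorm_def hprod_simps)
  \<comment> \<open>\<open>p\<close> is the orthogonal projection of the pair \<open>(f, f')\<close>
    onto the graph of \<open>S\<close>; the residual will be \<open>(u, v)\<close>.\<close>
  obtain p where p: "p \<in> S" and orth: "\<And>q. q \<in> S \<Longrightarrow> hinner (hprod H H) q ((f, f') - p) = 0"
  proof (rule P.orthogonal_decomposition[of S "(f, f')"])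
    show "P.subspace S"
      using linear_operatorD(4-6)[OF lin] by (auto simp: P.subspace_def hprod_simps zero_prod_def)
    show "S \<subseteq> hcarrier (hprod H H)" using S_mem by (auto simp: hprod_simps)
    show "(f, f') \<in> hcarrier (hprod H H)" using ff' by (simp add: hprod_simps)
    fix X :: "nat \<Rightarrow> 'a \<times> 'a" and p
    assume X: "\<And>n. X n \<in> S" and p: "p \<in> hcarrier (hprod H H)"
      and lim: "(\<lambda>n. hnorm (hprod H H) (X n - p)) \<longlonglongrightarrow> 0"
    have mem: "fst (X n) \<in> hcarrier H" "snd (X n) \<in> hcarrier H" for n
      using X[of n] S_mem by (metis prod.collapse)+
    have p': "fst p \<in> hcarrier H" "snd p \<in> hcarrier H" using p by (auto simp: hprod_simps)
    have diff: "fst (X n - p) \<in> hcarrier H" "snd (X n - p) \<in> hcarrier H" for n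
      using mem p' by (auto simp: carrier_closed)
    have "(\<lambda>n. hnorm H (fst (X n - p))) \<longlonglongrightarrow> 0" "(\<lambda>n. hnorm H (snd (X n - p))) \<longlonglongrightarrow> 0"
      using norm_le[OF diff] hnorm_nonneg diff
      by (intro tendsto_sandwich[OF _ _ tendsto_const lim] always_eventually; simp)+
    then have "(fst p, snd p) \<in> S"
      using cl X p' unfolding closed_operator_def
      by (elim allE[of _ "\<lambda>n. fst (X n)"] allE[of _ "\<lambda>n. snd (X n)"]
          allE[of _ "fst p"] allE[of _ "snd p"]) simp
    then show "p \<in> S" by simp
  qed blast
  obtain s s' where ss': "p = (s, s')" by fastforce
  have s: "(s, s') \<in> adjoint H S" "s \<in> hcarrier H" "s' \<in> hcarrier H"
    using p ss' S_mem symmetric_subset_adjoint[OF S] by auto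
  have *: "hinner H a (f - s) + hinner H a' (f' - s') = 0" if "(a, a') \<in> S" for a a'
    using orth[OF that] by (simp add: ss' hprod_simps)
  have "(f - s, f' - s') \<in> adjoint H S"
    using f s S_mem by (auto simp: adjoint_def carrier_closed inner_simps)
  \<comment> \<open>Orthogonality to \<open>(a, a')\<close> in \<open>S\<close> reads
    \<open>(a, u) + (a', v) = 0\<close>, that is \<open>(a', v) = (a, - u)\<close>, which is the
    defining identity of the adjoint at \<open>(v, - u)\<close>. Deleting
    \<open>minus_diff_eq\<close> keeps \<open>- (f - s)\<close> from being rewritten to
    \<open>s - f\<close>.\<close>
  moreover have "(f' - s', - (f - s)) \<in> adjoint H S"
    using * s ff' S_mem
    by (auto simp: adjoint_def carrier_closed inner_minus_right[of _ "f - s"] eq_neg_iff_add_eq_0 add.commute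
        simp del: minus_diff_eq)
  ultimately show thesis
    using p ss' by (intro that[of "f - s" "f' - s'"]) auto
qed

end

section \<open>Graph norm estimates for boundary maps and for their right inverses\<close>

text \<open>By homogeneity, a bound on the graph norm unit ball extends to all vectors; a vector of
  graph norm 0 is 0, and so is its image. The constant is nonnegative because \<open>ennreal\<close>
  sends negative reals to 0.\<close>

lemma boundary_map_norm_le_iff:
  assumes H: "hilbert_space H" and G: "hilbert_space G" and S: "S \<subseteq> hcarrier H \<times> hcarrier H"
    and \<Gamma>: "linear_operator H G \<Gamma>" and C: "0 \<le> C"
  shows "boundary_map_norm H S G \<Gamma> \<le> ennreal C \<longleftrightarrow>
    (\<forall>f f' h. (f, f') \<in> adjoint H S \<longrightarrow> (f, h) \<in> \<Gamma> \<longrightarrow> hnorm G h \<le> C * graph_norm H f f')"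
    (is "?L \<longleftrightarrow> ?R")
proof -
  interpret H: hilbert_space H by fact
  interpret G: hilbert_space G by fact
  have le: "?L \<longleftrightarrow> (\<forall>f f' h. (f, f') \<in> adjoint H S \<longrightarrow> (f, h) \<in> \<Gamma> \<longrightarrow>
      graph_norm H f f' \<le> 1 \<longrightarrow> hnorm G h \<le> C)"
    using C by (auto simp: boundary_map_norm_def SUP_le_iff)
  show ?thesis
  proof
    assume ?L
    show ?R
    proof (intro allI impI)
      fix f f' h assume ff': "(f, f') \<in> adjoint H S" and h: "(f, h) \<in> \<Gamma>"
      note mem = linear_operatorD(1,2)[OF \<Gamma> h]
      have f': "f' \<in> hcarrier H" using ff' by (auto simp: adjoint_def)
      let ?n = "graph_norm H f f'"
      show "hnorm G h \<le> C * ?n"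
      proof (cases "?n = 0")
        case True
        then have "f = 0"
          using mem H.hnorm_eq_zero by (simp add: graph_norm_def sum_power2_eq_zero_iff)
        then have "h = 0" using h linear_operatorD(3,4)[OF \<Gamma>] by blast
        then show ?thesis using True by (simp add: G.hnorm_zero)
      next
        case False
        then have n: "?n > 0" by (simp add: graph_norm_def order_less_le)
        let ?c = "complex_of_real (1 / ?n)"
        have "(hscale H ?c f, hscale H ?c f') \<in> adjoint H S" "(hscale H ?c f, hscale G ?c h) \<in> \<Gamma>"
          using H.scale_adjoint[OF S ff'] linear_operatorD(6)[OF \<Gamma> h] by auto
        moreover have "graph_norm H (hscale H ?c f) (hscale H ?c f') \<le> 1"
          using n mem f' by (simp add: H.graph_norm_scale norm_divide)
        ultimately have "hnorm G (hscale G ?c h) \<le> C" using \<open>?L\<close> le by blast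
        then show ?thesis using n mem by (simp add: G.hnorm_scale norm_divide field_simps)
      qed
    qed
  next
    assume R: ?R
    have "hnorm G h \<le> C" if "(f, f') \<in> adjoint H S" "(f, h) \<in> \<Gamma>" "graph_norm H f f' \<le> 1" for f f' h
      using R that mult_left_mono[OF that(3) C] by force
    then show ?L using le by blast
  qed
qed

lemma boundary_tripletD:
  assumes "boundary_triplet H S G \<Gamma>\<^sub>0 \<Gamma>\<^sub>1"
  shows "hilbert_space H" "closed_symmetric_operator H S" "equal_deficiency_indices H S" "hilbert_space G"
    and "linear_operator H G \<Gamma>\<^sub>0" "linear_operator H G \<Gamma>\<^sub>1"
    and "Domain \<Gamma>\<^sub>0 = Domain (adjoint H S)" "Domain \<Gamma>\<^sub>1 = Domain (adjoint H S)"
    and "\<lbrakk>(f, f') \<in> adjoint H S; (g, g') \<in> adjoint H S;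
          (f, f\<^sub>0) \<in> \<Gamma>\<^sub>0; (f, f\<^sub>1) \<in> \<Gamma>\<^sub>1; (g, g\<^sub>0) \<in> \<Gamma>\<^sub>0; (g, g\<^sub>1) \<in> \<Gamma>\<^sub>1\<rbrakk>
        \<Longrightarrow> hinner H f' g - hinner H f g' = hinner G f\<^sub>1 g\<^sub>0 - hinner G f\<^sub>0 g\<^sub>1"
    and "\<lbrakk>h\<^sub>0 \<in> hcarrier G; h\<^sub>1 \<in> hcarrier G\<rbrakk> \<Longrightarrow> \<exists>f. (f, h\<^sub>0) \<in> \<Gamma>\<^sub>0 \<and> (f, h\<^sub>1) \<in> \<Gamma>\<^sub>1"
proof -
  note * = assms[unfolded boundary_triplet_def]
  show "hilbert_space H" "closed_symmetric_operator H S" "equal_deficiency_indices H S" "hilbert_space G"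
    "linear_operator H G \<Gamma>\<^sub>0" "linear_operator H G \<Gamma>\<^sub>1"
    "Domain \<Gamma>\<^sub>0 = Domain (adjoint H S)" "Domain \<Gamma>\<^sub>1 = Domain (adjoint H S)"
    using * by simp_all
  show "\<lbrakk>(f, f') \<in> adjoint H S; (g, g') \<in> adjoint H S;
          (f, f\<^sub>0) \<in> \<Gamma>\<^sub>0; (f, f\<^sub>1) \<in> \<Gamma>\<^sub>1; (g, g\<^sub>0) \<in> \<Gamma>\<^sub>0; (g, g\<^sub>1) \<in> \<Gamma>\<^sub>1\<rbrakk>
        \<Longrightarrow> hinner H f' g - hinner H f g' = hinner G f\<^sub>1 g\<^sub>0 - hinner G f\<^sub>0 g\<^sub>1"
    by (rule *[THEN conjunct2, THEN conjunct2, THEN conjunct2, THEN conjunct2, THEN conjunct2,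
          THEN conjunct1, rule_format])
  show "\<lbrakk>h\<^sub>0 \<in> hcarrier G; h\<^sub>1 \<in> hcarrier G\<rbrakk> \<Longrightarrow> \<exists>f. (f, h\<^sub>0) \<in> \<Gamma>\<^sub>0 \<and> (f, h\<^sub>1) \<in> \<Gamma>\<^sub>1"
    by (rule *[THEN conjunct2, THEN conjunct2, THEN conjunct2, THEN conjunct2, THEN conjunct2,
          THEN conjunct2, rule_format])
qed

text \<open>Surjectivity supplies a \<open>g\<close> with boundary values \<open>f\<^sub>1\<close>
  and \<open>- f\<^sub>0\<close>. Against this \<open>g\<close> the left side of Green's identity is
  zero, since \<open>f\<close> is in the domain of \<open>S\<close>, while the right side is the sum
  of the squared norms of \<open>f\<^sub>0\<close> and \<open>f\<^sub>1\<close>.\<close>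

lemma boundary_maps_vanish:
  assumes bt: "boundary_triplet H S G \<Gamma>\<^sub>0 \<Gamma>\<^sub>1" and f: "(f, f') \<in> S"
  shows "(f, 0) \<in> \<Gamma>\<^sub>0" "(f, 0) \<in> \<Gamma>\<^sub>1"
proof -
  note bt' = boundary_tripletD[OF bt]
  interpret G: hilbert_space G by (fact bt')
  have f': "(f, f') \<in> adjoint H S" using symmetric_subset_adjoint[OF bt'(2)] f by blast
  then obtain f\<^sub>0 f\<^sub>1 where f01: "(f, f\<^sub>0) \<in> \<Gamma>\<^sub>0" "(f, f\<^sub>1) \<in> \<Gamma>\<^sub>1" using bt'(7,8) by (metis DomainE DomainI)
  then have mem: "f\<^sub>0 \<in> hcarrier G" "f\<^sub>1 \<in> hcarrier G"
    using linear_operatorD(2) bt'(5,6) by blast+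
  then obtain g where g: "(g, f\<^sub>1) \<in> \<Gamma>\<^sub>0" "(g, - f\<^sub>0) \<in> \<Gamma>\<^sub>1" 
    using bt'(10)[OF mem(2) G.carrier_uminus[OF mem(1)]] by blast
  then obtain g' where g': "(g, g') \<in> adjoint H S" using bt'(7) by (metis DomainE DomainI)
  have "hinner H f' g = hinner H f g'" using g' f by (auto simp: adjoint_def)
  then have "hinner G f\<^sub>1 f\<^sub>1 + hinner G f\<^sub>0 f\<^sub>0 = 0"
    using bt'(9)[OF f' g' f01 g] mem by (simp add: G.inner_simps)
  then have "Re (hinner G f\<^sub>1 f\<^sub>1 + hinner G f\<^sub>0 f\<^sub>0) = 0" by simp
  then have "(hnorm G f\<^sub>1)\<^sup>2 + (hnorm G f\<^sub>0)\<^sup>2 = 0"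
    using mem by (simp add: G.hnorm_square)
  then have "f\<^sub>0 = 0" "f\<^sub>1 = 0"
    using mem by (simp_all add: sum_power2_eq_zero_iff G.hnorm_eq_zero)
  then show "(f, 0) \<in> \<Gamma>\<^sub>0" "(f, 0) \<in> \<Gamma>\<^sub>1" using f01 by auto
qed

text \<open>A right inverse of the pair of boundary maps whose bound depends on \<open>C\<close>
  alone. For a sequence of triplets with a common \<open>C\<close>, the preimages are thus
  controlled uniformly.\<close>

lemma boundary_triplet_lift:
  assumes bt: "boundary_triplet H S G \<Gamma>\<^sub>0 \<Gamma>\<^sub>1"
    and h: "h\<^sub>0 \<in> hcarrier G" "h\<^sub>1 \<in> hcarrier G" and C: "0 \<le> C"
    and bound: "\<And>\<Gamma> f f' h. \<lbrakk>\<Gamma> \<in> {\<Gamma>\<^sub>0, \<Gamma>\<^sub>1}; (f, f') \<in> adjoint H S; (f, h) \<in> \<Gamma>\<rbrakk>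
      \<Longrightarrow> hnorm G h \<le> C * graph_norm H f f'"
  obtains f f' where "(f, f') \<in> adjoint H S" "(f, h\<^sub>0) \<in> \<Gamma>\<^sub>0" "(f, h\<^sub>1) \<in> \<Gamma>\<^sub>1"
    "graph_norm H f f' \<le> C * (hnorm G h\<^sub>0 + hnorm G h\<^sub>1)"
proof -
  note bt' = boundary_tripletD[OF bt]
  interpret H: hilbert_space H by (fact bt')
  interpret G: hilbert_space G by (fact bt')
  obtain f where f: "(f, h\<^sub>0) \<in> \<Gamma>\<^sub>0" "(f, h\<^sub>1) \<in> \<Gamma>\<^sub>1" using bt'(10)[OF h] by blast
  then obtain f' where "(f, f') \<in> adjoint H S" using bt'(7) by (metis DomainE DomainI)
  then obtain u v where uv: "(u, v) \<in> adjoint H S" "(v, - u) \<in> adjoint H S" "(f - u, f' - v) \<in> S"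
    using H.adjoint_decomposition bt'(2) by metis
  have mem: "u \<in> hcarrier H" "v \<in> hcarrier H" using uv by (auto simp: adjoint_def)
  \<comment> \<open>\<open>f\<close> and \<open>u\<close> differ by an element of the domain of
    \<open>S\<close>, where both boundary maps vanish, so \<open>u\<close> has the boundary values
    of \<open>f\<close>.\<close>
  have u: "(u, h\<^sub>0) \<in> \<Gamma>\<^sub>0" "(u, h\<^sub>1) \<in> \<Gamma>\<^sub>1"
    using boundary_maps_vanish[OF bt uv(3)] f bt'(1,4,5,6) linear_operator_diff[of H G _ f _ "f - u" 0]
    by auto
  obtain k\<^sub>0 k\<^sub>1 where k: "(v, k\<^sub>0) \<in> \<Gamma>\<^sub>0" "(v, k\<^sub>1) \<in> \<Gamma>\<^sub>1" using bt'(7,8) uv(2) by (metis DomainE DomainI)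
  then have k_mem: "k\<^sub>0 \<in> hcarrier G" "k\<^sub>1 \<in> hcarrier G"
    using linear_operatorD(2) bt'(5,6) by blast+
  let ?n = "graph_norm H u v"
  \<comment> \<open>The adjoint maps \<open>v\<close> to \<open>- u\<close>, so passing from
    \<open>u\<close> to \<open>v\<close> only swaps the two terms of the graph norm. Hence the
    boundary values of \<open>v\<close> are bounded by the graph norm of \<open>u\<close>.\<close>
  have n: "graph_norm H v (- u) = ?n" "0 \<le> ?n"
    using mem by (simp_all add: graph_norm_def H.hnorm_uminus add.commute)
  have k_le: "hnorm G k\<^sub>0 \<le> C * ?n" "hnorm G k\<^sub>1 \<le> C * ?n"
    using bound uv(2) k n by (metis insertCI)+
  have "?n\<^sup>2 = (hnorm H u)\<^sup>2 + (hnorm H v)\<^sup>2"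
    by (simp add: graph_norm_def)
  \<comment> \<open>This is the left side of Green's identity for the pairs \<open>(u, v)\<close>
    and \<open>(v, - u)\<close>.\<close>
  also have "\<dots> = Re (hinner H v v - hinner H u (- u))"
    using mem by (simp add: H.hnorm_square H.inner_simps)
  also have "\<dots> = Re (hinner G h\<^sub>1 k\<^sub>0 - hinner G h\<^sub>0 k\<^sub>1)"
    using bt'(9)[OF uv(1,2) u k] by simp
  also have "\<dots> \<le> cmod (hinner G h\<^sub>1 k\<^sub>0) + cmod (hinner G h\<^sub>0 k\<^sub>1)"
    by (rule order_trans[OF complex_Re_le_cmod norm_triangle_ineq4])
  also have "\<dots> \<le> hnorm G h\<^sub>1 * hnorm G k\<^sub>0 + hnorm G h\<^sub>0 * hnorm G k\<^sub>1"
    using h k_mem by (intro add_mono G.cmod_inner_le)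
  also have "\<dots> \<le> hnorm G h\<^sub>1 * (C * ?n) + hnorm G h\<^sub>0 * (C * ?n)"
    using k_le h by (intro add_mono mult_left_mono G.hnorm_nonneg)
  also have "\<dots> = ?n * (C * (hnorm G h\<^sub>0 + hnorm G h\<^sub>1))"
    by (simp add: algebra_simps)
  finally have "?n * ?n \<le> ?n * (C * (hnorm G h\<^sub>0 + hnorm G h\<^sub>1))"
    by (simp add: power2_eq_square)
  \<comment> \<open>One factor \<open>?n\<close> is cancelled; when it is zero, the claim holds
    because the right side is nonnegative.\<close>
  then have "?n \<le> C * (hnorm G h\<^sub>0 + hnorm G h\<^sub>1)"
    using n(2) C G.hnorm_nonneg h by (cases "?n = 0") (auto simp: mult_le_cancel_left)
  with uv(1) u show thesis by (rule that)
qed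

section \<open>Direct sums of Hilbert spaces\<close>

definition hdsum_embed :: "nat \<Rightarrow> 'a::zero \<Rightarrow> nat \<Rightarrow> 'a" where
  "hdsum_embed n x = (\<lambda>m. if m = n then x else 0)"

lemma hdsum_embed_simps: "hdsum_embed n x n = x" "m \<noteq> n \<Longrightarrow> hdsum_embed n x m = 0"
  by (simp_all add: hdsum_embed_def)

locale hilbert_sequence =
  fixes H :: "nat \<Rightarrow> 'a::ab_group_add hspace"
  assumes hilbert: "\<And>n. hilbert_space (H n)"
begin

sublocale comp: hilbert_space "H n" for n by (rule hilbert)

lemma hdsum_mem_iff:
  "f \<in> hcarrier (hdsum H) \<longleftrightarrow>
    (\<forall>n. f n \<in> hcarrier (H n)) \<and> summable (\<lambda>n. (hnorm (H n) (f n))\<^sup>2)"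
  by (simp add: hdsum_def)

lemma hdsum_memD:
  assumes "f \<in> hcarrier (hdsum H)"
  shows "f n \<in> hcarrier (H n)" "summable (\<lambda>n. (hnorm (H n) (f n))\<^sup>2)"
  using assms by (auto simp: hdsum_mem_iff)

lemma hscale_hdsum: "hscale (hdsum H) c f = (\<lambda>n. hscale (H n) c (f n))"
  by (simp add: hdsum_def)

lemma hinner_hdsum: "hinner (hdsum H) f g = (\<Sum>n. hinner (H n) (f n) (g n))"
  by (simp add: hdsum_def)

text \<open>Termwise Cauchy-Schwarz and \<open>x * y \<le> x\<^sup>2 + y\<^sup>2\<close> for
  nonnegative reals. This justifies splitting the series that define inner products in the direct
  sum.\<close>

lemma summable_hinner:
  assumes "f \<in> hcarrier (hdsum H)" "g \<in> hcarrier (hdsum H)"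
  shows "summable (\<lambda>n. hinner (H n) (f n) (g n))"
proof (rule summable_comparison_test')
  show "summable (\<lambda>n. (hnorm (H n) (f n))\<^sup>2 + (hnorm (H n) (g n))\<^sup>2)"
    using assms by (intro summable_add hdsum_memD)
  show "norm (hinner (H n) (f n) (g n)) \<le> (hnorm (H n) (f n))\<^sup>2 + (hnorm (H n) (g n))\<^sup>2" for n
  proof -
    let ?x = "hnorm (H n) (f n)" and ?y = "hnorm (H n) (g n)"
    have "norm (hinner (H n) (f n) (g n)) \<le> ?x * ?y"
      using assms by (intro comp.cmod_inner_le hdsum_memD)
    also have "\<dots> \<le> ?x\<^sup>2 + ?y\<^sup>2"
    proof -
      have "0 \<le> ?x * ?y"
        using assms by (intro mult_nonneg_nonneg comp.hnorm_nonneg hdsum_memD)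
      then show ?thesis using sum_squares_bound[of ?x ?y] by linarith
    qed
    finally show ?thesis .
  qed
qed

lemma inner_self_hdsum:
  assumes "f \<in> hcarrier (hdsum H)"
  shows "hinner (hdsum H) f f = of_real (\<Sum>n. (hnorm (H n) (f n))\<^sup>2)"
  using hdsum_memD[OF assms] by (simp only: hinner_hdsum comp.inner_self suminf_of_real)

lemma hnorm_hdsum:
  assumes "f \<in> hcarrier (hdsum H)"
  shows "(hnorm (hdsum H) f)\<^sup>2 = (\<Sum>n. (hnorm (H n) (f n))\<^sup>2)" "0 \<le> hnorm (hdsum H) f"
  using suminf_nonneg[OF hdsum_memD(2)[OF assms]]
  by (simp_all add: hnorm_def[of "hdsum H"] inner_self_hdsum[OF assms])

lemma hdsum_scale_mem: "f \<in> hcarrier (hdsum H) \<Longrightarrow> hscale (hdsum H) c f \<in> hcarrier (hdsum H)"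
  by (auto simp: hdsum_mem_iff hscale_hdsum comp.carrier_closed comp.hnorm_scale power_mult_distrib
      intro: summable_mult)

lemma hdsum_add_mem:
  assumes "f \<in> hcarrier (hdsum H)" "g \<in> hcarrier (hdsum H)"
  shows "f + g \<in> hcarrier (hdsum H)"
proof -
  have "summable (\<lambda>n. (hnorm (H n) (f n + g n))\<^sup>2)"
  proof (rule summable_comparison_test')
    show "summable (\<lambda>n. 2 * (hnorm (H n) (f n))\<^sup>2 + 2 * (hnorm (H n) (g n))\<^sup>2)"
      using assms by (intro summable_add summable_mult hdsum_memD)
  qed (use assms comp.hnorm_add_square_le in \<open>auto simp: hdsum_mem_iff\<close>)
  then show ?thesis using assms by (auto simp: hdsum_mem_iff comp.carrier_closed)
qed

lemma hdsum_zero_mem: "0 \<in> hcarrier (hdsum H)"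
  by (simp add: hdsum_mem_iff comp.carrier_closed comp.hnorm_zero)

lemma vector_space_hdsum: "vector_space (hscale (hdsum H))"
  by unfold_locales
    (auto simp: hscale_hdsum fun_eq_iff comp.scale_right_distrib comp.scale_left_distrib)

lemma hdsum_diff_mem:
  assumes "f \<in> hcarrier (hdsum H)" "g \<in> hcarrier (hdsum H)"
  shows "f - g \<in> hcarrier (hdsum H)"
proof -
  interpret vector_space "hscale (hdsum H)" by (rule vector_space_hdsum)
  show ?thesis using hdsum_add_mem[OF assms(1) hdsum_scale_mem[OF assms(2), of "-1"]] by simp
qed

text \<open>A single term of a series of squares is at most its sum. Coordinate projections are
  therefore contractions and preserve Cauchy sequences and limits.\<close>

lemma hnorm_component_le:
  assumes "f \<in> hcarrier (hdsum H)"
  shows "hnorm (H n) (f n) \<le> hnorm (hdsum H) f"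
proof -
  have "(\<Sum>i\<in>{n}. (hnorm (H i) (f i))\<^sup>2) \<le> (hnorm (hdsum H) f)\<^sup>2"
    unfolding hnorm_hdsum(1)[OF assms] by (intro sum_le_suminf hdsum_memD[OF assms]) auto
  then show ?thesis by (intro power2_le_imp_le[OF _ hnorm_hdsum(2)[OF assms]]) simp
qed

text \<open>The componentwise limit \<open>x\<close> is the candidate. The Cauchy estimate is first
  restricted to finitely many components, where the limit may be taken, and then extended to the
  whole series.\<close>

lemma hdsum_complete:
  assumes X: "\<And>k::nat. X k \<in> hcarrier (hdsum H)"
    and C: "\<forall>e>0. \<exists>N. \<forall>m\<ge>N. \<forall>n\<ge>N. hnorm (hdsum H) (X m - X n) < e"
  shows "\<exists>x\<in>hcarrier (hdsum H). (\<lambda>k. hnorm (hdsum H) (X k - x)) \<longlonglongrightarrow> 0"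
proof -
  have diff: "X k - X m \<in> hcarrier (hdsum H)" for k m using X by (intro hdsum_diff_mem)
  have "\<exists>x\<in>hcarrier (H n). (\<lambda>k. hnorm (H n) (X k n - x)) \<longlonglongrightarrow> 0" for n
  proof (rule comp.complete)
    have "hnorm (H n) (X k n - X m n) \<le> hnorm (hdsum H) (X k - X m)" for k m
      using hnorm_component_le[OF diff, of n k m] by simp
    then show "\<forall>e>0. \<exists>N. \<forall>k\<ge>N. \<forall>m\<ge>N. hnorm (H n) (X k n - X m n) < e"
      using C order_le_less_trans by (metis (no_types, lifting))
  qed (use X in \<open>auto simp: hdsum_mem_iff\<close>)
  then obtain x where x: "\<And>n. x n \<in> hcarrier (H n)"
    and lim: "\<And>n. (\<lambda>k. hnorm (H n) (X k n - x n)) \<longlonglongrightarrow> 0" by metis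
  \<comment> \<open>Membership and estimate come together: the same bound on partial sums gives
    summability and the size of the sum.\<close>
  have close: "X k - x \<in> hcarrier (hdsum H) \<and> hnorm (hdsum H) (X k - x) \<le> e"
    if e: "0 < e" and k: "k \<ge> K" and K: "\<And>k m. \<lbrakk>k \<ge> K; m \<ge> K\<rbrakk> \<Longrightarrow> hnorm (hdsum H) (X k - X m) < e"
    for e k K
  proof -
    \<comment> \<open>With \<open>k\<close> and \<open>N\<close> fixed, \<open>m\<close> tends to
      infinity; the bound \<open>e\<^sup>2\<close> does not depend on \<open>N\<close>.\<close>
    have bound: "(\<Sum>n<N. (hnorm (H n) (X k n - x n))\<^sup>2) \<le> e\<^sup>2" for N
    proof (rule LIMSEQ_le_const2)
      have "(\<lambda>m. hnorm (H n) (X m n - X k n)) \<longlonglongrightarrow> hnorm (H n) (x n - X k n)" for n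
        using hdsum_memD(1)[OF X] x lim by (intro comp.LIMSEQ_hnorm_diff)
      then have "(\<lambda>m. hnorm (H n) (X k n - X m n)) \<longlonglongrightarrow> hnorm (H n) (X k n - x n)" for n
        using x hdsum_memD(1)[OF X] by (simp add: comp.hnorm_minus_commute[of "X k n"])
      then show "(\<lambda>m. \<Sum>n<N. (hnorm (H n) (X k n - X m n))\<^sup>2) \<longlonglongrightarrow>
          (\<Sum>n<N. (hnorm (H n) (X k n - x n))\<^sup>2)"
        by (intro tendsto_intros)
      have "(\<Sum>n<N. (hnorm (H n) (X k n - X m n))\<^sup>2) \<le> e\<^sup>2" if "m \<ge> K" for m
      proof -
        have "(\<Sum>n<N. (hnorm (H n) ((X k - X m) n))\<^sup>2) \<le> (hnorm (hdsum H) (X k - X m))\<^sup>2"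
          unfolding hnorm_hdsum(1)[OF diff] by (intro sum_le_suminf hdsum_memD[OF diff]) auto
        also have "\<dots> \<le> e\<^sup>2"
          using K[OF k that] hnorm_hdsum(2)[OF diff] by (intro power_mono) auto
        finally show ?thesis by simp
      qed
      then show "\<exists>M. \<forall>m\<ge>M. (\<Sum>n<N. (hnorm (H n) (X k n - X m n))\<^sup>2) \<le> e\<^sup>2" by blast
    qed
    then have sm: "summable (\<lambda>n. (hnorm (H n) (X k n - x n))\<^sup>2)"
      by (intro summableI_nonneg_bounded) auto
    then have mem: "X k - x \<in> hcarrier (hdsum H)"
      using X x by (auto simp: hdsum_mem_iff comp.carrier_closed)
    have "(hnorm (hdsum H) (X k - x))\<^sup>2 \<le> e\<^sup>2"
      unfolding hnorm_hdsum(1)[OF mem] using suminf_le_const[OF sm bound] by simp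
    then show ?thesis using mem e by (auto intro: power2_le_imp_le)
  qed
  obtain K where "\<And>k m. \<lbrakk>k \<ge> K; m \<ge> K\<rbrakk> \<Longrightarrow> hnorm (hdsum H) (X k - X m) < 1"
    using C[rule_format, OF zero_less_one] by blast
  \<comment> \<open>Any fixed tolerance would do here. One far enough member of the sequence
    suffices, as \<open>x\<close> is the difference of \<open>X K\<close> and
    \<open>X K - x\<close>.\<close>
  then have "X K - x \<in> hcarrier (hdsum H)"
    using close[of 1 K K] by auto
  then have mem: "x \<in> hcarrier (hdsum H)"
    using hdsum_diff_mem[OF X[of K], of "X K - x"] by simp
  have "(\<lambda>k. hnorm (hdsum H) (X k - x)) \<longlonglongrightarrow> 0"
  proof (rule LIMSEQ_I)
    fix r :: real assume r: "0 < r"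
    then obtain K where K: "\<And>k m. \<lbrakk>k \<ge> K; m \<ge> K\<rbrakk> \<Longrightarrow> hnorm (hdsum H) (X k - X m) < r / 2"
      using C[rule_format, OF half_gt_zero[OF r]] by blast
    have "0 \<le> hnorm (hdsum H) (X k - x)" for k
      by (intro hnorm_hdsum(2) hdsum_diff_mem X mem)
    then have "norm (hnorm (hdsum H) (X k - x) - 0) < r" if "k \<ge> K" for k
      using close[OF half_gt_zero[OF r] that K] r by auto
    then show "\<exists>K. \<forall>k\<ge>K. norm (hnorm (hdsum H) (X k - x) - 0) < r" by blast
  qed
  with mem show ?thesis by blast
qed

sublocale dsum: hilbert_space "hdsum H"
proof (intro hilbert_space.intro hilbert_space_axioms.intro vector_space_hdsum)
  interpret vector_space "hscale (hdsum H)" by (rule vector_space_hdsum)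
  show "subspace (hcarrier (hdsum H))"
    using hdsum_zero_mem hdsum_add_mem hdsum_scale_mem by (simp add: subspace_def)
next
  fix f g h assume "f \<in> hcarrier (hdsum H)" "g \<in> hcarrier (hdsum H)" "h \<in> hcarrier (hdsum H)"
  then show "hinner (hdsum H) (f + g) h = hinner (hdsum H) f h + hinner (hdsum H) g h"
    by (simp add: hinner_hdsum comp.inner_add_left hdsum_memD suminf_add summable_hinner)
next
  fix f g c assume fg: "f \<in> hcarrier (hdsum H)" "g \<in> hcarrier (hdsum H)"
  then show "hinner (hdsum H) (hscale (hdsum H) c f) g = c * hinner (hdsum H) f g"
    by (simp add: hinner_hdsum hscale_hdsum comp.inner_scale_left hdsum_memD suminf_mult summable_hinner)
  show "hinner (hdsum H) g f = cnj (hinner (hdsum H) f g)"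
    unfolding hinner_hdsum bounded_linear.suminf[OF bounded_linear_cnj summable_hinner[OF fg]]
    using fg by (intro suminf_cong comp.inner_commute hdsum_memD)
next
  fix f assume f: "f \<in> hcarrier (hdsum H)"
  show "0 \<le> Re (hinner (hdsum H) f f)"
    unfolding inner_self_hdsum[OF f] using suminf_nonneg[OF hdsum_memD(2)[OF f]] by simp
  assume "hinner (hdsum H) f f = 0"
  then have "f n = 0" for n
    using hdsum_memD[OF f] comp.hnorm_eq_zero unfolding inner_self_hdsum[OF f]
    by (simp add: suminf_eq_zero_iff)
  then show "f = 0" by auto
qed (use hdsum_complete in blast)

lemma hdsum_embed_mem: "hdsum_embed n x \<in> hcarrier (hdsum H)" if "x \<in> hcarrier (H n)"
proof -
  have "summable (\<lambda>m. (hnorm (H m) (hdsum_embed n x m))\<^sup>2)"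
    by (intro summable_finite[of "{n}"]) (auto simp: hdsum_embed_simps comp.hnorm_zero)
  then show ?thesis using that by (auto simp: hdsum_mem_iff hdsum_embed_def comp.carrier_zero)
qed

lemma inner_embed_right: "hinner (hdsum H) f (hdsum_embed n x) = hinner (H n) (f n) x"
  if "f \<in> hcarrier (hdsum H)"
proof -
  have "(\<Sum>m. hinner (H m) (f m) (hdsum_embed n x m)) = (\<Sum>m\<in>{n}. hinner (H m) (f m) (hdsum_embed n x m))"
    using hdsum_memD(1)[OF that]
    by (intro suminf_finite) (auto simp: hdsum_embed_simps comp.inner_zero_right)
  then show ?thesis by (simp add: hinner_hdsum hdsum_embed_simps)
qed

lemma hnorm_embed: "hnorm (hdsum H) (hdsum_embed n x) = hnorm (H n) x" if "x \<in> hcarrier (H n)"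
  using inner_embed_right[OF hdsum_embed_mem[OF that], of n x] by (simp add: hnorm_def hdsum_embed_simps)

end

section \<open>Direct sums of operators and boundary triplets\<close>

lemma dsum_operator_iff:
  "(f, g) \<in> dsum_operator H K T \<longleftrightarrow>
    f \<in> hcarrier (hdsum H) \<and> g \<in> hcarrier (hdsum K) \<and> (\<forall>n. (f n, g n) \<in> T n)"
  by (simp add: dsum_operator_def)

lemma dsum_operator_closed:
  assumes "hilbert_sequence H" "hilbert_sequence K"
  shows "(\<And>n. (0, 0) \<in> T n) \<Longrightarrow> (0, 0) \<in> dsum_operator H K T"
    and "\<lbrakk>\<And>n x y x' y'. \<lbrakk>(x, y) \<in> T n; (x', y') \<in> T n\<rbrakk> \<Longrightarrow> (x + x', y + y') \<in> T n;
        (f, g) \<in> dsum_operator H K T; (f', g') \<in> dsum_operator H K T\<rbrakk>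
      \<Longrightarrow> (f + f', g + g') \<in> dsum_operator H K T"
    and "\<lbrakk>\<And>n x y. (x, y) \<in> T n \<Longrightarrow> (hscale (H n) c x, hscale (K n) c y) \<in> T n;
        (f, g) \<in> dsum_operator H K T\<rbrakk>
      \<Longrightarrow> (hscale (hdsum H) c f, hscale (hdsum K) c g) \<in> dsum_operator H K T"
proof -
  interpret H: hilbert_sequence H by fact
  interpret K: hilbert_sequence K by fact
  show "(\<And>n. (0, 0) \<in> T n) \<Longrightarrow> (0, 0) \<in> dsum_operator H K T"
    by (simp add: dsum_operator_iff H.hdsum_zero_mem K.hdsum_zero_mem)
  show "\<lbrakk>\<And>n x y x' y'. \<lbrakk>(x, y) \<in> T n; (x', y') \<in> T n\<rbrakk> \<Longrightarrow> (x + x', y + y') \<in> T n;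
        (f, g) \<in> dsum_operator H K T; (f', g') \<in> dsum_operator H K T\<rbrakk>
      \<Longrightarrow> (f + f', g + g') \<in> dsum_operator H K T"
    by (simp add: dsum_operator_iff H.hdsum_add_mem K.hdsum_add_mem)
  show "\<lbrakk>\<And>n x y. (x, y) \<in> T n \<Longrightarrow> (hscale (H n) c x, hscale (K n) c y) \<in> T n;
        (f, g) \<in> dsum_operator H K T\<rbrakk>
      \<Longrightarrow> (hscale (hdsum H) c f, hscale (hdsum K) c g) \<in> dsum_operator H K T"
    by (simp add: dsum_operator_iff H.hdsum_scale_mem K.hdsum_scale_mem)
      (simp add: H.hscale_hdsum K.hscale_hdsum)
qed

lemma linear_operator_dsum:
  assumes "hilbert_sequence H" "hilbert_sequence K" and T: "\<And>n. linear_operator (H n) (K n) (T n)"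
  shows "linear_operator (hdsum H) (hdsum K) (dsum_operator H K T)"
  unfolding linear_operator_def
proof (intro conjI allI impI)
  show "dsum_operator H K T \<subseteq> hcarrier (hdsum H) \<times> hcarrier (hdsum K)"
    by (auto simp: dsum_operator_iff)
  show "single_valued (dsum_operator H K T)"
  proof (rule single_valuedI)
    fix f g g' assume "(f, g) \<in> dsum_operator H K T" "(f, g') \<in> dsum_operator H K T"
    then have "(f n, g n) \<in> T n" "(f n, g' n) \<in> T n" for n by (simp_all add: dsum_operator_iff)
    then have "g n = g' n" for n using linear_operatorD(3)[OF T] by blast
    then show "g = g'" by auto
  qed
qed (intro dsum_operator_closed assms(1,2) linear_operatorD[OF T]; assumption)+

lemma embed_dsum_operator:
  assumes "hilbert_sequence H" "hilbert_sequence K"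
    and "(x, y) \<in> T n" "x \<in> hcarrier (H n)" "y \<in> hcarrier (K n)" "\<And>m. (0, 0) \<in> T m"
  shows "(hdsum_embed n x, hdsum_embed n y) \<in> dsum_operator H K T"
  using assms by (simp add: dsum_operator_iff hilbert_sequence.hdsum_embed_mem) (simp add: hdsum_embed_def)

context hilbert_space
begin

lemma adjoint_zero: "(0, 0) \<in> adjoint H S" if "S \<subseteq> hcarrier H \<times> hcarrier H"
  using that by (force simp: adjoint_def carrier_closed inner_simps)

lemma adjoint_add:
  "\<lbrakk>(f, f') \<in> adjoint H S; (g, g') \<in> adjoint H S\<rbrakk> \<Longrightarrow> (f + g, f' + g') \<in> adjoint H S"
  if "S \<subseteq> hcarrier H \<times> hcarrier H"
  using that by (force simp: adjoint_def carrier_closed inner_simps)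

end

section \<open>Direct sums of closed symmetric operators and their deficiency indices\<close>

locale closed_symmetric_sequence = hilbert_sequence H for H :: "nat \<Rightarrow> 'a::ab_group_add hspace" +
  fixes S :: "nat \<Rightarrow> ('a, 'a) operator"
  assumes csym: "\<And>n. closed_symmetric_operator (H n) (S n)"
begin

lemma linear: "linear_operator (H n) (H n) (S n)"
  using csym by (simp add: closed_symmetric_operator_def)

lemma S_subset: "S n \<subseteq> hcarrier (H n) \<times> hcarrier (H n)"
  using linear by (simp add: linear_operator_def)

lemma linear_dsum: "linear_operator (hdsum H) (hdsum H) (dsum_operator H H S)"
  by (intro linear_operator_dsum hilbert_sequence_axioms linear)

lemma adjoint_dsum: "adjoint (hdsum H) (dsum_operator H H S) = dsum_operator H H (\<lambda>n. adjoint (H n) (S n))"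
  by (intro adjoint_dsum_operator hilbert linear)

text \<open>The tail of \<open>x\<close> is cut off and each remaining component is approximated in
  its own space, with the squared error budget split evenly between tail and head.\<close>

lemma densely_defined_dsum: "densely_defined (hdsum H) (dsum_operator H H S)"
  unfolding densely_defined_def
proof (intro ballI allI impI)
  fix x and e :: real
  assume x: "x \<in> hcarrier (hdsum H)" and e: "0 < e"
  note x' = hdsum_memD[OF x]
  obtain N where N: "norm (\<Sum>i. (hnorm (H (i + N)) (x (i + N)))\<^sup>2) < e\<^sup>2 / 2"
    using suminf_exist_split[OF _ x'(2), of "e\<^sup>2 / 2"] e by auto
  \<comment> \<open>Chosen so that \<open>N\<close> errors of size \<open>r\<close> contribute at
    most \<open>e\<^sup>2 / 2\<close> to the squared norm; \<open>Suc N\<close> avoids division by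
    zero when \<open>N = 0\<close>.\<close>
  define r where "r = e / sqrt (2 * real (Suc N))"
  have r: "0 < r" "r\<^sup>2 = e\<^sup>2 / (2 * real (Suc N))"
    using e by (simp_all add: r_def power_divide)
  have "\<exists>f g. (f, g) \<in> S n \<and> hnorm (H n) (x n - f) < r" for n
    using csym[of n] x'(1)[of n] r(1) unfolding closed_symmetric_operator_def densely_defined_def by blast
  then obtain f g where fg: "\<And>n. (f n, g n) \<in> S n" and f: "\<And>n. hnorm (H n) (x n - f n) < r"
    by metis
  have fg_mem: "f n \<in> hcarrier (H n)" "g n \<in> hcarrier (H n)" for n
    using fg S_subset by blast+
  \<comment> \<open>Finite support puts both sequences into the direct sum, although nothing bounds
    the norms of the values \<open>g n\<close>.\<close>
  define p q where "p = (\<lambda>n. if n < N then f n else 0)" and "q = (\<lambda>n. if n < N then g n else 0)"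
  have "summable (\<lambda>n. (hnorm (H n) (p n))\<^sup>2)" "summable (\<lambda>n. (hnorm (H n) (q n))\<^sup>2)"
    by (intro summable_finite[of "{..<N}"]; simp add: p_def q_def comp.hnorm_zero)+
  then have mem: "p \<in> hcarrier (hdsum H)" "q \<in> hcarrier (hdsum H)"
    using fg_mem comp.carrier_zero by (simp_all add: hdsum_mem_iff p_def q_def)
  moreover have "(p n, q n) \<in> S n" for n
    using fg linear_operatorD(4)[OF linear] by (simp add: p_def q_def)
  ultimately have pq: "(p, q) \<in> dsum_operator H H S" by (simp add: dsum_operator_iff)
  have xp: "x - p \<in> hcarrier (hdsum H)" using x mem by (intro hdsum_diff_mem)
  have "(hnorm (hdsum H) (x - p))\<^sup>2 =
      (\<Sum>i. (hnorm (H (i + N)) (x (i + N)))\<^sup>2) + (\<Sum>i<N. (hnorm (H i) (x i - f i))\<^sup>2)"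
    unfolding hnorm_hdsum(1)[OF xp] suminf_split_initial_segment[OF hdsum_memD(2)[OF xp], of N]
    by (simp add: p_def)
  also have "\<dots> < e\<^sup>2 / 2 + real N * r\<^sup>2"
  proof (rule add_less_le_mono)
    show "(\<Sum>i. (hnorm (H (i + N)) (x (i + N)))\<^sup>2) < e\<^sup>2 / 2" using N by simp
    have "(hnorm (H i) (x i - f i))\<^sup>2 \<le> r\<^sup>2" for i
      using f[of i] x'(1) fg_mem by (intro power_mono) (auto intro: comp.hnorm_nonneg comp.carrier_diff)
    then show "(\<Sum>i<N. (hnorm (H i) (x i - f i))\<^sup>2) \<le> real N * r\<^sup>2"
      using sum_bounded_above[of "{..<N}" "\<lambda>i. (hnorm (H i) (x i - f i))\<^sup>2" "r\<^sup>2"] by simp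
  qed
  also have "\<dots> \<le> e\<^sup>2"
    unfolding r by (simp add: field_simps)
  finally have "hnorm (hdsum H) (x - p) < e" using e power2_less_imp_less by fastforce
  then show "\<exists>f\<in>Domain (dsum_operator H H S). hnorm (hdsum H) (x - f) < e"
    using pq by blast
qed

text \<open>Convergence in the direct sum implies convergence of every component, so each
  \<open>S n\<close> can be applied separately. Square summability of the limits is already part of
  the assumptions on \<open>f\<close> and \<open>g\<close>.\<close>

lemma closed_dsum: "closed_operator (hdsum H) (hdsum H) (dsum_operator H H S)"
  unfolding closed_operator_def
proof (intro allI impI)
  fix F G f g
  assume FG: "\<forall>k::nat. (F k, G k) \<in> dsum_operator H H S"
    and f: "f \<in> hcarrier (hdsum H)" and g: "g \<in> hcarrier (hdsum H)"
    and lim: "(\<lambda>k. hnorm (hdsum H) (F k - f)) \<longlonglongrightarrow> 0" "(\<lambda>k. hnorm (hdsum H) (G k - g)) \<longlonglongrightarrow> 0"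
  have comp_lim: "(\<lambda>k. hnorm (H n) (X k n - x n)) \<longlonglongrightarrow> 0"
    if X: "\<And>k. X k \<in> hcarrier (hdsum H)" "x \<in> hcarrier (hdsum H)"
      and lim: "(\<lambda>k. hnorm (hdsum H) (X k - x)) \<longlonglongrightarrow> 0" for X x n
  proof (rule tendsto_sandwich[OF always_eventually always_eventually tendsto_const lim]; intro allI)
    fix k
    have mem: "X k - x \<in> hcarrier (hdsum H)" using X by (intro hdsum_diff_mem)
    show "0 \<le> hnorm (H n) (X k n - x n)" "hnorm (H n) (X k n - x n) \<le> hnorm (hdsum H) (X k - x)"
      using comp.hnorm_nonneg[OF hdsum_memD(1)[OF mem]] hnorm_component_le[OF mem, of n] by simp_all
  qed
  have "(f n, g n) \<in> S n" for n
  proof -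
    have "closed_operator (H n) (H n) (S n)" using csym by (simp add: closed_symmetric_operator_def)
    moreover have "(F k n, G k n) \<in> S n" for k using FG by (simp add: dsum_operator_iff)
    moreover have "(\<lambda>k. hnorm (H n) (F k n - f n)) \<longlonglongrightarrow> 0" "(\<lambda>k. hnorm (H n) (G k n - g n)) \<longlonglongrightarrow> 0"
      using FG f g lim by (intro comp_lim; simp add: dsum_operator_iff)+
    ultimately show ?thesis
      using hdsum_memD(1)[OF f] hdsum_memD(1)[OF g] unfolding closed_operator_def
      by (elim allE[of _ "\<lambda>k. F k n"] allE[of _ "\<lambda>k. G k n"] allE[of _ "f n"] allE[of _ "g n"]) simp
  qed
  with f g show "(f, g) \<in> dsum_operator H H S" by (simp add: dsum_operator_iff)
qed

lemma symmetric_dsum: "symmetric_operator (hdsum H) (dsum_operator H H S)"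
proof -
  have "hinner (H n) y u = hinner (H n) x v" if "(x, y) \<in> S n" "(u, v) \<in> S n" for n x y u v
    using csym[of n] that by (simp add: closed_symmetric_operator_def symmetric_operator_def)
  then show ?thesis
    unfolding symmetric_operator_def dsum_operator_iff hinner_hdsum
    by (intro allI impI suminf_cong) blast
qed

lemma closed_symmetric_dsum: "closed_symmetric_operator (hdsum H) (dsum_operator H H S)"
  by (simp add: closed_symmetric_operator_def linear_dsum densely_defined_dsum closed_dsum symmetric_dsum)

text \<open>The adjoint acts componentwise. Its summability condition on the image is automatic
  here, since the image is a multiple of \<open>f\<close>.\<close>

lemma deficiency_space_dsum:
  "f \<in> deficiency_space (hdsum H) (dsum_operator H H S) z \<longleftrightarrow>
    f \<in> hcarrier (hdsum H) \<and> (\<forall>n. f n \<in> deficiency_space (H n) (S n) z)"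
  by (auto simp: deficiency_space_def adjoint_dsum dsum_operator_iff hdsum_scale_mem)
    (auto simp: hscale_hdsum)

text \<open>Vectors from different summands are orthogonal. The system is maximal because an inner
  product with an embedded vector only sees one component, so maximality of each \<open>B n\<close>
  applies.\<close>

lemma orthonormal_basis_dsum:
  assumes B: "\<And>n. orthonormal_basis (H n) (deficiency_space (H n) (S n) z) (B n)"
  shows "orthonormal_basis (hdsum H) (deficiency_space (hdsum H) (dsum_operator H H S) z)
    (\<Union>n. hdsum_embed n ` B n)"
  unfolding orthonormal_basis_def
proof (intro conjI ballI impI)
  have B_def: "x \<in> deficiency_space (H n) (S n) z" "x \<in> hcarrier (H n)" if "x \<in> B n" for n x
    using B[of n] that by (auto simp: orthonormal_basis_def deficiency_space_def adjoint_def)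
  have zero: "0 \<in> deficiency_space (H n) (S n) z" for n
    using comp.adjoint_zero[OF S_subset] by (simp add: deficiency_space_def)
  show "(\<Union>n. hdsum_embed n ` B n) \<subseteq> deficiency_space (hdsum H) (dsum_operator H H S) z"
    using B_def zero by (auto simp: deficiency_space_dsum hdsum_embed_mem) (simp add: hdsum_embed_def)
  fix x assume "x \<in> (\<Union>n. hdsum_embed n ` B n)"
  then obtain n b where x: "x = hdsum_embed n b" and b: "b \<in> B n" by blast
  fix y assume "y \<in> (\<Union>n. hdsum_embed n ` B n)"
  then obtain m c where y: "y = hdsum_embed m c" and c: "c \<in> B m" by blast
  have inner: "hinner (hdsum H) x y = hinner (H m) (hdsum_embed n b m) c"
    using B_def b by (simp add: x y inner_embed_right hdsum_embed_mem)
  have on: "hinner (H k) u v = (if u = v then 1 else 0)" if "u \<in> B k" "v \<in> B k" for u v k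
    using B[of k] that by (auto simp: orthonormal_basis_def)
  show "hinner (hdsum H) x y = (if x = y then 1 else 0)"
  proof (cases "m = n")
    case True
    then have "x = y \<longleftrightarrow> b = c" unfolding x y by (metis hdsum_embed_simps(1))
    then show ?thesis using on b c True by (simp add: inner hdsum_embed_simps)
  next
    case False
    \<comment> \<open>Only the zero vector could have equal embeddings in two different slots, and a
      unit vector is not zero.\<close>
    have "b \<noteq> 0" using on[OF b b] B_def[OF b] comp.inner_zero_left by auto
    then have "x \<noteq> y" using False unfolding x y by (metis hdsum_embed_simps)
    then show ?thesis using False B_def[OF c] by (simp add: inner hdsum_embed_simps comp.inner_zero_left)
  qed
next
  fix x assume x: "x \<in> deficiency_space (hdsum H) (dsum_operator H H S) z"
    and orth: "\<forall>b\<in>\<Union>n. hdsum_embed n ` B n. hinner (hdsum H) x b = 0"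
  then have x_mem: "x \<in> hcarrier (hdsum H)" by (simp add: deficiency_space_dsum)
  have "x n = 0" for n
  proof -
    have "hinner (H n) (x n) b = 0" if "b \<in> B n" for b
      using orth that inner_embed_right[OF x_mem, of n b] by force
    then show ?thesis
      using B[of n] x by (simp add: orthonormal_basis_def deficiency_space_dsum)
  qed
  then show "x = 0" by auto
qed

text \<open>The embedded bases of the summands are pairwise disjoint, so the bijections between
  \<open>B n\<close> and \<open>C n\<close> glue to one between the unions. No cardinal arithmetic
  is involved.\<close>

lemma equal_deficiency_indices_dsum:
  assumes "\<And>n. equal_deficiency_indices (H n) (S n)"
  shows "equal_deficiency_indices (hdsum H) (dsum_operator H H S)"
proof -
  obtain B C where B: "\<And>n. orthonormal_basis (H n) (deficiency_space (H n) (S n) \<i>) (B n)"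
    and C: "\<And>n. orthonormal_basis (H n) (deficiency_space (H n) (S n) (- \<i>)) (C n)"
    and BC: "\<And>n. B n \<approx> C n"
    using assms unfolding equal_deficiency_indices_def by metis
  have inj: "inj_on (hdsum_embed n) A" for n and A :: "'a set"
    by (intro inj_onI) (metis hdsum_embed_simps(1))
  \<comment> \<open>Disjointness needs that no basis contains 0, whose embeddings into all slots
    coincide.\<close>
  have disj: "pairwise (\<lambda>m n. disjnt (hdsum_embed m ` A m) (hdsum_embed n ` A n)) UNIV"
    if A: "\<And>n. orthonormal_basis (H n) (V n) (A n)" for A V
  proof (intro pairwiseI)
    fix m n :: nat assume mn: "m \<noteq> n"
    have "0 \<notin> A m"
    proof
      assume "0 \<in> A m"
      then have "hinner (H m) 0 0 = 1" using A[of m] by (auto simp: orthonormal_basis_def)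
      then show False using comp.inner_zero_left[OF comp.carrier_zero] by simp
    qed
    then show "disjnt (hdsum_embed m ` A m) (hdsum_embed n ` A n)"
      using mn by (auto simp: disjnt_iff) (metis hdsum_embed_simps)
  qed
  have "hdsum_embed n ` B n \<approx> hdsum_embed n ` C n" for n
    using BC[of n] inj by (meson eqpoll_sym eqpoll_trans inj_on_image_eqpoll_self)
  then have "(\<Union>n. hdsum_embed n ` B n) \<approx> (\<Union>n. hdsum_embed n ` C n)"
    using disj[OF B] disj[OF C] by (intro UN_eqpoll_UN)
  then show ?thesis
    using orthonormal_basis_dsum[OF B] orthonormal_basis_dsum[OF C]
    unfolding equal_deficiency_indices_def by blast
qed

end

lemma (in hilbert_sequence) graph_norm_hdsum:
  assumes "f \<in> hcarrier (hdsum H)" "f' \<in> hcarrier (hdsum H)"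
  shows "(graph_norm (hdsum H) f f')\<^sup>2 = (\<Sum>n. (graph_norm (H n) (f n) (f' n))\<^sup>2)"
    and "summable (\<lambda>n. (graph_norm (H n) (f n) (f' n))\<^sup>2)"
proof -
  note summable = hdsum_memD(2)[OF assms(1)] hdsum_memD(2)[OF assms(2)]
  have *: "(graph_norm K x y)\<^sup>2 = (hnorm K x)\<^sup>2 + (hnorm K y)\<^sup>2" for K :: "'c hspace" and x y
    by (simp add: graph_norm_def)
  show "summable (\<lambda>n. (graph_norm (H n) (f n) (f' n))\<^sup>2)"
    unfolding * by (intro summable_add summable)
  show "(graph_norm (hdsum H) f f')\<^sup>2 = (\<Sum>n. (graph_norm (H n) (f n) (f' n))\<^sup>2)"
    unfolding * hnorm_hdsum(1)[OF assms(1)] hnorm_hdsum(1)[OF assms(2)] by (rule suminf_add[OF summable])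
qed

section \<open>Direct sums of boundary triplets\<close>

locale boundary_triplet_sequence = closed_symmetric_sequence H S + G: hilbert_sequence G
  for H :: "nat \<Rightarrow> 'a::ab_group_add hspace" and S :: "nat \<Rightarrow> ('a, 'a) operator"
    and G :: "nat \<Rightarrow> 'b::ab_group_add hspace" +
  fixes \<Gamma>\<^sub>0 \<Gamma>\<^sub>1 :: "nat \<Rightarrow> ('a, 'b) operator"
  assumes bt: "\<And>n. boundary_triplet (H n) (S n) (G n) (\<Gamma>\<^sub>0 n) (\<Gamma>\<^sub>1 n)"
begin

text \<open>The condition \<open>\<Gamma> \<in> {\<Gamma>\<^sub>0, \<Gamma>\<^sub>1}\<close> lets
  the arguments below treat both boundary maps at once.\<close>

lemma component_maps:
  assumes "\<Gamma> \<in> {\<Gamma>\<^sub>0, \<Gamma>\<^sub>1}"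
  shows "linear_operator (H n) (G n) (\<Gamma> n)" "Domain (\<Gamma> n) = Domain (adjoint (H n) (S n))"
  using assms boundary_tripletD(5-8)[OF bt, of n] by (elim insertE emptyE; simp)+

lemma dsum_boundary_map_iff:
  "(f, h) \<in> dsum_boundary_map H S G \<Gamma> \<longleftrightarrow>
    (f, h) \<in> dsum_operator H G \<Gamma> \<and> (\<exists>f'. (f, f') \<in> adjoint (hdsum H) (dsum_operator H H S))"
  by (auto simp: dsum_boundary_map_def adjoint_dsum)

lemma linear_operator_dsum_boundary_map:
  assumes "\<Gamma> \<in> {\<Gamma>\<^sub>0, \<Gamma>\<^sub>1}"
  shows "linear_operator (hdsum H) (hdsum G) (dsum_boundary_map H S G \<Gamma>)"
proof -
  have "linear_operator (hdsum H) (hdsum G) (dsum_operator H G \<Gamma>)"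
    using component_maps(1)[OF assms]
    by (intro linear_operator_dsum hilbert_sequence_axioms G.hilbert_sequence_axioms)
  note lin = linear_operatorD[OF this]
  have sub: "dsum_operator H H S \<subseteq> hcarrier (hdsum H) \<times> hcarrier (hdsum H)"
    by (auto simp: dsum_operator_iff)
  show ?thesis
    unfolding linear_operator_def
  proof (intro conjI allI impI)
    show "dsum_boundary_map H S G \<Gamma> \<subseteq> hcarrier (hdsum H) \<times> hcarrier (hdsum G)"
      using lin(1,2) by (auto simp: dsum_boundary_map_iff)
    show "single_valued (dsum_boundary_map H S G \<Gamma>)"
      using lin(3) by (auto simp: dsum_boundary_map_iff intro!: single_valuedI)
    show "(0, 0) \<in> dsum_boundary_map H S G \<Gamma>"
      using lin(4) dsum.adjoint_zero[OF sub] by (auto simp: dsum_boundary_map_iff)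
  next
    fix f g f' g' assume "(f, g) \<in> dsum_boundary_map H S G \<Gamma>" "(f', g') \<in> dsum_boundary_map H S G \<Gamma>"
    then show "(f + f', g + g') \<in> dsum_boundary_map H S G \<Gamma>"
      using lin(5) dsum.adjoint_add[OF sub] unfolding dsum_boundary_map_iff by blast
  next
    fix c f g assume "(f, g) \<in> dsum_boundary_map H S G \<Gamma>"
    then show "(hscale (hdsum H) c f, hscale (hdsum G) c g) \<in> dsum_boundary_map H S G \<Gamma>"
      using lin(6) dsum.scale_adjoint[OF sub] unfolding dsum_boundary_map_iff by blast
  qed
qed

text \<open>Embedding into the \<open>n\<close>-th slot preserves the norms of \<open>x\<close>,
  \<open>x'\<close> and \<open>y\<close>, so a bound on the direct sum passes to each summand with
  the same constant.\<close>

lemma component_bound: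
  assumes \<Gamma>: "\<Gamma> \<in> {\<Gamma>\<^sub>0, \<Gamma>\<^sub>1}"
    and C: "\<And>f f' h. \<lbrakk>(f, f') \<in> adjoint (hdsum H) (dsum_operator H H S);
      (f, h) \<in> dsum_boundary_map H S G \<Gamma>\<rbrakk> \<Longrightarrow> hnorm (hdsum G) h \<le> C * graph_norm (hdsum H) f f'"
    and f: "(x, x') \<in> adjoint (H n) (S n)" "(x, y) \<in> \<Gamma> n"
  shows "hnorm (G n) y \<le> C * graph_norm (H n) x x'"
proof -
  have mem: "x \<in> hcarrier (H n)" "x' \<in> hcarrier (H n)" "y \<in> hcarrier (G n)"
    using f linear_operatorD(2)[OF component_maps(1)[OF \<Gamma>]] by (auto simp: adjoint_def)
  have adj: "(hdsum_embed n x, hdsum_embed n x') \<in> adjoint (hdsum H) (dsum_operator H H S)"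
    unfolding adjoint_dsum using f(1) mem comp.adjoint_zero[OF S_subset]
    by (intro embed_dsum_operator hilbert_sequence_axioms)
  have "(hdsum_embed n x, hdsum_embed n y) \<in> dsum_operator H G \<Gamma>"
    using f(2) mem linear_operatorD(4)[OF component_maps(1)[OF \<Gamma>]]
    by (intro embed_dsum_operator hilbert_sequence_axioms G.hilbert_sequence_axioms)
  then have "hnorm (hdsum G) (hdsum_embed n y) \<le> C * graph_norm (hdsum H) (hdsum_embed n x) (hdsum_embed n x')"
    using adj by (intro C) (auto simp: dsum_boundary_map_iff)
  then show ?thesis using mem by (simp add: graph_norm_def hnorm_embed G.hnorm_embed)
qed

text \<open>Here \<open>h\<close> is any componentwise choice of boundary values, and its square
  summability is a conclusion. This is what makes the direct sum map defined on the whole domain of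
  the adjoint.\<close>

lemma dsum_boundary_map_bound:
  assumes \<Gamma>: "\<Gamma> \<in> {\<Gamma>\<^sub>0, \<Gamma>\<^sub>1}" and C: "0 \<le> C"
    and bound: "\<And>n x x' y. \<lbrakk>(x, x') \<in> adjoint (H n) (S n); (x, y) \<in> \<Gamma> n\<rbrakk>
      \<Longrightarrow> hnorm (G n) y \<le> C * graph_norm (H n) x x'"
    and f: "(f, f') \<in> adjoint (hdsum H) (dsum_operator H H S)" and h: "\<And>n. (f n, h n) \<in> \<Gamma> n"
  shows "h \<in> hcarrier (hdsum G)" "hnorm (hdsum G) h \<le> C * graph_norm (hdsum H) f f'"
proof -
  have f_mem: "f \<in> hcarrier (hdsum H)" "f' \<in> hcarrier (hdsum H)"
    and f_adj: "\<And>n. (f n, f' n) \<in> adjoint (H n) (S n)"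
    using f by (auto simp: adjoint_dsum dsum_operator_iff)
  note gn = graph_norm_hdsum[OF f_mem]
  have h_mem: "h n \<in> hcarrier (G n)" for n
    using linear_operatorD(2)[OF component_maps(1)[OF \<Gamma>] h] .
  have sq: "(hnorm (G n) (h n))\<^sup>2 \<le> C\<^sup>2 * (graph_norm (H n) (f n) (f' n))\<^sup>2" for n
    using power_mono[OF bound[OF f_adj h] G.comp.hnorm_nonneg[OF h_mem], of n 2]
    by (simp add: power_mult_distrib)
  have "summable (\<lambda>n. (hnorm (G n) (h n))\<^sup>2)"
    using sq by (intro summable_comparison_test'[OF summable_mult[OF gn(2), of "C\<^sup>2"]]) simp
  then show mem: "h \<in> hcarrier (hdsum G)" using h_mem by (simp add: G.hdsum_mem_iff)
  have "(hnorm (hdsum G) h)\<^sup>2 \<le> (\<Sum>n. C\<^sup>2 * (graph_norm (H n) (f n) (f' n))\<^sup>2)"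
    unfolding G.hnorm_hdsum(1)[OF mem]
    by (intro suminf_le sq G.hdsum_memD(2)[OF mem] summable_mult gn(2))
  also have "\<dots> = (C * graph_norm (hdsum H) f f')\<^sup>2"
    by (simp add: suminf_mult[OF gn(2)] gn(1) power_mult_distrib)
  finally show "hnorm (hdsum G) h \<le> C * graph_norm (hdsum H) f f'"
    by (rule power2_le_imp_le) (simp add: C graph_norm_def)
qed

text \<open>The boundary values are lifted in each summand by \<open>boundary_triplet_lift\<close>.
  As the constant is uniform, the chosen preimages and their images under the adjoints are square
  summable.\<close>

lemma dsum_boundary_maps_surj:
  assumes C: "0 \<le> C"
    and bound: "\<And>\<Gamma> n x x' y. \<lbrakk>\<Gamma> \<in> {\<Gamma>\<^sub>0, \<Gamma>\<^sub>1}; (x, x') \<in> adjoint (H n) (S n); (x, y) \<in> \<Gamma> n\<rbrakk>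
      \<Longrightarrow> hnorm (G n) y \<le> C * graph_norm (H n) x x'"
    and h: "h\<^sub>0 \<in> hcarrier (hdsum G)" "h\<^sub>1 \<in> hcarrier (hdsum G)"
  shows "\<exists>f. (f, h\<^sub>0) \<in> dsum_boundary_map H S G \<Gamma>\<^sub>0 \<and> (f, h\<^sub>1) \<in> dsum_boundary_map H S G \<Gamma>\<^sub>1"
proof -
  note h_mem = G.hdsum_memD(1)[OF h(1)] G.hdsum_memD(1)[OF h(2)]
  have "\<exists>x x'. (x, x') \<in> adjoint (H n) (S n) \<and> (x, h\<^sub>0 n) \<in> \<Gamma>\<^sub>0 n \<and> (x, h\<^sub>1 n) \<in> \<Gamma>\<^sub>1 n \<and>
      graph_norm (H n) x x' \<le> C * (hnorm (G n) (h\<^sub>0 n) + hnorm (G n) (h\<^sub>1 n))" for n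
  proof (rule boundary_triplet_lift[OF bt h_mem C])
    show "hnorm (G n) y \<le> C * graph_norm (H n) x x'"
      if "\<Gamma> \<in> {\<Gamma>\<^sub>0 n, \<Gamma>\<^sub>1 n}" "(x, x') \<in> adjoint (H n) (S n)" "(x, y) \<in> \<Gamma>" for \<Gamma> x x' y
      using that bound[of \<Gamma>\<^sub>0] bound[of \<Gamma>\<^sub>1] by auto
  qed blast
  then obtain f f' where f: "\<And>n. (f n, f' n) \<in> adjoint (H n) (S n)"
    and fh: "\<And>n. (f n, h\<^sub>0 n) \<in> \<Gamma>\<^sub>0 n" "\<And>n. (f n, h\<^sub>1 n) \<in> \<Gamma>\<^sub>1 n"
    and le: "\<And>n. graph_norm (H n) (f n) (f' n) \<le> C * (hnorm (G n) (h\<^sub>0 n) + hnorm (G n) (h\<^sub>1 n))"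
    by metis
  have f_mem: "f n \<in> hcarrier (H n)" "f' n \<in> hcarrier (H n)" for n
    using f[of n] by (auto simp: adjoint_def)
  \<comment> \<open>A summable majorant for the squared graph norms, obtained from \<open>le\<close>
    and \<open>(x + y)\<^sup>2 \<le> 2 * x\<^sup>2 + 2 * y\<^sup>2\<close>.\<close>
  define B where "B = (\<lambda>n. C\<^sup>2 * (2 * (hnorm (G n) (h\<^sub>0 n))\<^sup>2 + 2 * (hnorm (G n) (h\<^sub>1 n))\<^sup>2))"
  have B: "summable B"
    unfolding B_def by (intro summable_mult summable_add G.hdsum_memD(2) h)
  have sq: "(hnorm (H n) (f n))\<^sup>2 + (hnorm (H n) (f' n))\<^sup>2 \<le> B n" for n
  proof -
    have "(hnorm (H n) (f n))\<^sup>2 + (hnorm (H n) (f' n))\<^sup>2 = (graph_norm (H n) (f n) (f' n))\<^sup>2"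
      by (simp add: graph_norm_def)
    also have "\<dots> \<le> C\<^sup>2 * (hnorm (G n) (h\<^sub>0 n) + hnorm (G n) (h\<^sub>1 n))\<^sup>2"
      using power_mono[OF le, of n 2] by (simp add: graph_norm_def power_mult_distrib)
    also have "\<dots> \<le> B n"
      unfolding B_def
      using sum_squares_bound[of "hnorm (G n) (h\<^sub>0 n)" "hnorm (G n) (h\<^sub>1 n)"]
      by (intro mult_left_mono) (simp_all add: power2_sum)
    finally show ?thesis .
  qed
  have "(hnorm (H n) (f n))\<^sup>2 \<le> B n" "(hnorm (H n) (f' n))\<^sup>2 \<le> B n" for n
    using sq[of n] zero_le_power2[of "hnorm (H n) (f n)"] zero_le_power2[of "hnorm (H n) (f' n)"]
    by linarith+
  then have "summable (\<lambda>n. (hnorm (H n) (f n))\<^sup>2)" "summable (\<lambda>n. (hnorm (H n) (f' n))\<^sup>2)"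
    by (intro summable_comparison_test'[OF B]; simp)+
  then have "f \<in> hcarrier (hdsum H)" "f' \<in> hcarrier (hdsum H)"
    using f_mem by (simp_all add: hdsum_mem_iff)
  then have "(f, h\<^sub>0) \<in> dsum_boundary_map H S G \<Gamma>\<^sub>0 \<and> (f, h\<^sub>1) \<in> dsum_boundary_map H S G \<Gamma>\<^sub>1"
    using f fh h by (auto simp: dsum_boundary_map_iff adjoint_dsum dsum_operator_iff)
  then show ?thesis by blast
qed

text \<open>Sufficiency, with the two suprema replaced by one real constant valid for all
  \<open>n\<close> and both maps. Domain and boundedness follow from the termwise estimate,
  surjectivity from the uniform lifting.\<close>

lemma boundary_triplet_dsum:
  assumes def: "\<And>n. equal_deficiency_indices (H n) (S n)" and C: "0 \<le> C"
    and bound: "\<And>\<Gamma> n x x' y. \<lbrakk>\<Gamma> \<in> {\<Gamma>\<^sub>0, \<Gamma>\<^sub>1}; (x, x') \<in> adjoint (H n) (S n); (x, y) \<in> \<Gamma> n\<rbrakk>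
      \<Longrightarrow> hnorm (G n) y \<le> C * graph_norm (H n) x x'"
  shows "boundary_triplet (hdsum H) (dsum_operator H H S) (hdsum G)
    (dsum_boundary_map H S G \<Gamma>\<^sub>0) (dsum_boundary_map H S G \<Gamma>\<^sub>1)"
proof -
  have maps: "linear_operator (hdsum H) (hdsum G) (dsum_boundary_map H S G \<Gamma>) \<and>
      Domain (dsum_boundary_map H S G \<Gamma>) = Domain (adjoint (hdsum H) (dsum_operator H H S)) \<and>
      (\<exists>C. \<forall>f f' h. (f, f') \<in> adjoint (hdsum H) (dsum_operator H H S) \<longrightarrow>
        (f, h) \<in> dsum_boundary_map H S G \<Gamma> \<longrightarrow> hnorm (hdsum G) h \<le> C * graph_norm (hdsum H) f f')"
    if \<Gamma>: "\<Gamma> \<in> {\<Gamma>\<^sub>0, \<Gamma>\<^sub>1}" for \<Gamma>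
  proof (intro conjI linear_operator_dsum_boundary_map[OF \<Gamma>] subset_antisym subsetI exI allI impI)
    fix f assume "f \<in> Domain (dsum_boundary_map H S G \<Gamma>)"
    then show "f \<in> Domain (adjoint (hdsum H) (dsum_operator H H S))"
      by (auto simp: dsum_boundary_map_iff)
  next
    fix f assume "f \<in> Domain (adjoint (hdsum H) (dsum_operator H H S))"
    then obtain f' where f: "(f, f') \<in> adjoint (hdsum H) (dsum_operator H H S)" by blast
    then have f_mem: "f \<in> hcarrier (hdsum H)" and "f n \<in> Domain (adjoint (H n) (S n))" for n
      by (auto simp: adjoint_dsum dsum_operator_iff)
    then have "\<exists>y. (f n, y) \<in> \<Gamma> n" for n using component_maps(2)[OF \<Gamma>] by blast
    then obtain h where h: "\<And>n. (f n, h n) \<in> \<Gamma> n" by metis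
    then have "h \<in> hcarrier (hdsum G)"
      using dsum_boundary_map_bound(1)[OF \<Gamma> C bound[OF \<Gamma>] f] by blast
    then have "(f, h) \<in> dsum_boundary_map H S G \<Gamma>"
      unfolding dsum_boundary_map_iff dsum_operator_iff using f f_mem h by blast
    then show "f \<in> Domain (dsum_boundary_map H S G \<Gamma>)" by blast
  next
    fix f f' h assume f: "(f, f') \<in> adjoint (hdsum H) (dsum_operator H H S)"
      and "(f, h) \<in> dsum_boundary_map H S G \<Gamma>"
    then have "(f n, h n) \<in> \<Gamma> n" for n by (simp add: dsum_boundary_map_iff dsum_operator_iff)
    then show "hnorm (hdsum G) h \<le> C * graph_norm (hdsum H) f f'"
      using dsum_boundary_map_bound(2)[OF \<Gamma> C bound[OF \<Gamma>] f] by blast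
  qed
  have green: "hinner (hdsum H) f' g - hinner (hdsum H) f g' = hinner (hdsum G) f\<^sub>1 g\<^sub>0 - hinner (hdsum G) f\<^sub>0 g\<^sub>1"
    if "(f, f') \<in> adjoint (hdsum H) (dsum_operator H H S)" "(g, g') \<in> adjoint (hdsum H) (dsum_operator H H S)"
      "(f, f\<^sub>0) \<in> dsum_boundary_map H S G \<Gamma>\<^sub>0" "(f, f\<^sub>1) \<in> dsum_boundary_map H S G \<Gamma>\<^sub>1"
      "(g, g\<^sub>0) \<in> dsum_boundary_map H S G \<Gamma>\<^sub>0" "(g, g\<^sub>1) \<in> dsum_boundary_map H S G \<Gamma>\<^sub>1"
    for f f' g g' f\<^sub>0 f\<^sub>1 g\<^sub>0 g\<^sub>1
  proof -
    have fg: "f \<in> hcarrier (hdsum H)" "f' \<in> hcarrier (hdsum H)" "g \<in> hcarrier (hdsum H)"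
        "g' \<in> hcarrier (hdsum H)" "f\<^sub>0 \<in> hcarrier (hdsum G)" "f\<^sub>1 \<in> hcarrier (hdsum G)"
        "g\<^sub>0 \<in> hcarrier (hdsum G)" "g\<^sub>1 \<in> hcarrier (hdsum G)"
      using that by (simp_all add: dsum_boundary_map_iff dsum_operator_iff adjoint_dsum)
    have "hinner (H n) (f' n) (g n) - hinner (H n) (f n) (g' n) =
        hinner (G n) (f\<^sub>1 n) (g\<^sub>0 n) - hinner (G n) (f\<^sub>0 n) (g\<^sub>1 n)" for n
      using that by (intro boundary_tripletD(9)[OF bt])
        (simp_all add: dsum_boundary_map_iff dsum_operator_iff adjoint_dsum)
    \<comment> \<open>Green's identity is summed over \<open>n\<close>; both sides split into
      differences because all four series converge.\<close>
    then show ?thesis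
      using fg by (simp add: hinner_hdsum G.hinner_hdsum suminf_diff summable_hinner G.summable_hinner)
  qed
  show ?thesis
    unfolding boundary_triplet_def
  proof (intro conjI dsum.hilbert_space_axioms G.dsum.hilbert_space_axioms
      closed_symmetric_dsum equal_deficiency_indices_dsum def)
    show "\<forall>\<Gamma>\<in>{dsum_boundary_map H S G \<Gamma>\<^sub>0, dsum_boundary_map H S G \<Gamma>\<^sub>1}.
        linear_operator (hdsum H) (hdsum G) \<Gamma> \<and>
        Domain \<Gamma> = Domain (adjoint (hdsum H) (dsum_operator H H S)) \<and>
        (\<exists>C. \<forall>f f' h. (f, f') \<in> adjoint (hdsum H) (dsum_operator H H S) \<longrightarrow> (f, h) \<in> \<Gamma> \<longrightarrow>
          hnorm (hdsum G) h \<le> C * graph_norm (hdsum H) f f')"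
      unfolding ball_simps by (intro conjI[OF maps conjI[OF maps TrueI]] insertI1 insertI2)
  qed (intro allI impI ballI green dsum_boundary_maps_surj[OF C bound]; assumption)+
qed

end

section \<open>Boundedness of the suprema as a criterion for the direct sum\<close>

theorem proposition3p8:
  fixes H :: "nat \<Rightarrow> 'a::ab_group_add hspace"
    and G :: "nat \<Rightarrow> 'b::ab_group_add hspace"
    and S :: "nat \<Rightarrow> ('a, 'a) operator"
    and \<Gamma>\<^sub>0 \<Gamma>\<^sub>1 :: "nat \<Rightarrow> ('a, 'b) operator"
  assumes "\<And>n. hilbert_space (H n)"
    and "\<And>n. closed_symmetric_operator (H n) (S n)"
    and "\<And>n. equal_deficiency_indices (H n) (S n)"
    and "\<And>n. boundary_triplet (H n) (S n) (G n) (\<Gamma>\<^sub>0 n) (\<Gamma>\<^sub>1 n)"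
  shows "boundary_triplet (hdsum H) (dsum_operator H H S) (hdsum G)
           (dsum_boundary_map H S G \<Gamma>\<^sub>0) (dsum_boundary_map H S G \<Gamma>\<^sub>1)
         \<longleftrightarrow>
         max (SUP n. boundary_map_norm (H n) (S n) (G n) (\<Gamma>\<^sub>0 n))
             (SUP n. boundary_map_norm (H n) (S n) (G n) (\<Gamma>\<^sub>1 n)) < \<infinity>"
    (is "?bt \<longleftrightarrow> max (?C \<Gamma>\<^sub>0) (?C \<Gamma>\<^sub>1) < \<infinity>")
proof -
  have G: "hilbert_space (G n)" for n by (rule boundary_tripletD(4)[OF assms(4)])
  interpret boundary_triplet_sequence H S G \<Gamma>\<^sub>0 \<Gamma>\<^sub>1
    by (intro boundary_triplet_sequence.intro closed_symmetric_sequence.intro hilbert_sequence.intro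
        closed_symmetric_sequence_axioms.intro boundary_triplet_sequence_axioms.intro assms G)
  have norm_le: "boundary_map_norm (H n) (S n) (G n) (\<Gamma> n) \<le> ennreal C \<longleftrightarrow>
      (\<forall>x x' y. (x, x') \<in> adjoint (H n) (S n) \<longrightarrow> (x, y) \<in> \<Gamma> n \<longrightarrow>
        hnorm (G n) y \<le> C * graph_norm (H n) x x')"
    if "\<Gamma> \<in> {\<Gamma>\<^sub>0, \<Gamma>\<^sub>1}" "0 \<le> C" for \<Gamma> n C
    by (intro boundary_map_norm_le_iff hilbert G S_subset component_maps that)
  show ?thesis
  proof
    assume ?bt
    have "?C \<Gamma> < \<infinity>" if \<Gamma>: "\<Gamma> \<in> {\<Gamma>\<^sub>0, \<Gamma>\<^sub>1}" for \<Gamma>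
    proof -
      obtain C where C: "\<And>f f' h. \<lbrakk>(f, f') \<in> adjoint (hdsum H) (dsum_operator H H S);
          (f, h) \<in> dsum_boundary_map H S G \<Gamma>\<rbrakk> \<Longrightarrow> hnorm (hdsum G) h \<le> C * graph_norm (hdsum H) f f'"
        using \<open>?bt\<close> \<Gamma> unfolding boundary_triplet_def by blast
      \<comment> \<open>The constant in \<open>boundary_triplet\<close> carries no sign, whereas
        \<open>norm_le\<close> asks for a nonnegative one.\<close>
      have "hnorm (G n) y \<le> \<bar>C\<bar> * graph_norm (H n) x x'"
        if "(x, x') \<in> adjoint (H n) (S n)" "(x, y) \<in> \<Gamma> n" for n x x' y
      proof -
        have "hnorm (G n) y \<le> C * graph_norm (H n) x x'"
          by (rule component_bound[OF \<Gamma> C that])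
        also have "\<dots> \<le> \<bar>C\<bar> * graph_norm (H n) x x'"
          by (intro mult_right_mono) (simp_all add: graph_norm_def)
        finally show ?thesis .
      qed
      then have "?C \<Gamma> \<le> ennreal \<bar>C\<bar>"
        using norm_le[OF \<Gamma>, of "\<bar>C\<bar>"] by (intro SUP_least) simp
      also have "\<dots> < \<infinity>" by simp
      finally show ?thesis .
    qed
    then show "max (?C \<Gamma>\<^sub>0) (?C \<Gamma>\<^sub>1) < \<infinity>" by simp
  next
    assume "max (?C \<Gamma>\<^sub>0) (?C \<Gamma>\<^sub>1) < \<infinity>"
    \<comment> \<open>A finite extended value is a nonnegative real, and this one bounds both
      families of norms.\<close>
    then obtain C where C: "0 \<le> C" "max (?C \<Gamma>\<^sub>0) (?C \<Gamma>\<^sub>1) = ennreal C"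
      by (cases "max (?C \<Gamma>\<^sub>0) (?C \<Gamma>\<^sub>1)" rule: ennreal_cases) auto
    show ?bt
    proof (rule boundary_triplet_dsum[OF assms(3) C(1)])
      fix \<Gamma> n x x' y
      assume \<Gamma>: "\<Gamma> \<in> {\<Gamma>\<^sub>0, \<Gamma>\<^sub>1}" and x: "(x, x') \<in> adjoint (H n) (S n)" "(x, y) \<in> \<Gamma> n"
      have "boundary_map_norm (H n) (S n) (G n) (\<Gamma> n) \<le> ?C \<Gamma>"
        by (intro SUP_upper UNIV_I)
      also have "\<dots> \<le> ennreal C" using \<Gamma> unfolding C(2)[symmetric] by auto
      finally show "hnorm (G n) y \<le> C * graph_norm (H n) x x'"
        using norm_le[OF \<Gamma> C(1)] x by blast
    qed
  qed
qed

end
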